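(* Let $\alpha\in\{1/2,1\}$, let $s_n=\alpha n$ for $n\ge1$, and let $k_0\ge0$ be an integer with $k_0\le s_1$. Let $\{Z_n\}_{n\ge 1}$ be the Markov chain with $Z_1=k_0$ and, for $n\ge1$, $$\Pr(Z_{n+1}-Z_n=1\mid Z_n)=1-\frac{Z_n}{s_n},\qquad \Pr(Z_{n+1}-Z_n=0\mid Z_n)=\frac{Z_n}{s_n}.$$ Then $Z_n/n$ satisfies the large deviation principle on $\mathbb{R}$ with speed $n$ and rate function $I(x)=\sup_{\lambda\in\mathbb{R}}\{\lambda x-\Lambda(\lambda)\}$, where the pressure $\Lambda(\lambda)=\lim_{n\to\infty}\frac1n\log E[e^{\lambda Z_n}]$ is given by $$\Lambda(\lambda)=-\log\left(\frac{\alpha}{e^\lambda-1}\int_0^\lambda\left(\frac{e^s-1}{e^\lambda-1}\right)^{\alpha-1}ds\right)\quad\text{for }\lambda\ne0,\qquad \Lambda(0)=0.$$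
   Context: A sequence $\{X_n\}$ of real random variables satisfies the large deviation principle with speed $n$ and rate function $I:\mathbb{R}\to[0,\infty]$ if the level sets $\{x: I(x)\le a\}$ are compact and for every Borel set $U\subset\mathbb{R}$, $$-\inf_{x\in U^\circ}I(x)\le\liminf_{n\to\infty}\frac1n\log\Pr(X_n\in U)\le\limsup_{n\to\infty}\frac1n\log\Pr(X_n\in U)\le-\inf_{x\in\bar U}I(x),$$ where $U^\circ$ is the interior and $\bar U$ the closure of $U$. In the cases considered one has $Z_n\le s_n$ for all $n$ almost surely, so the transition probabilities lie in $[0,1]$. *)

theory Defs
  imports "HOL-Probability.Probability"
begin

(* Time starts at 1, so Z 0 is unconstrained. The state space is discrete, so it suffices to
   condition on histories of positive probability (cond_prob is 0 on null histories). *)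
definition discrete_markov_chain :: "'a measure \<Rightarrow> (nat \<Rightarrow> 'a \<Rightarrow> 's::countable) \<Rightarrow> bool" where
  "discrete_markov_chain M Z \<longleftrightarrow>
     prob_space M \<and>
     (\<forall>n\<ge>1. Z n \<in> M \<rightarrow>\<^sub>M count_space UNIV) \<and>
     (\<forall>n\<ge>1. \<forall>x :: nat \<Rightarrow> 's. \<forall>y.
        \<P>(\<omega> in M. \<forall>i\<in>{1..n}. Z i \<omega> = x i) > 0 \<longrightarrow>
        \<P>(\<omega> in M. Z (Suc n) \<omega> = y \<bar> \<forall>i\<in>{1..n}. Z i \<omega> = x i)
          = \<P>(\<omega> in M. Z (Suc n) \<omega> = y \<bar> Z n \<omega> = x n))"

(* Logarithm of a probability, with log 0 = -\<infinity>; the library's ln has ln 0 = 0. *)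
definition elog :: "real \<Rightarrow> ereal" where
  "elog p = (if p = 0 then -\<infinity> else ereal (ln p))"

(* Infima are taken in ereal, so the infimum over the empty set is \<infinity>. *)
definition large_deviation_principle ::
    "'a measure \<Rightarrow> (nat \<Rightarrow> 'a \<Rightarrow> real) \<Rightarrow> (real \<Rightarrow> ereal) \<Rightarrow> bool" where
  "large_deviation_principle M X I \<longleftrightarrow>
     (\<forall>n\<ge>1. X n \<in> borel_measurable M) \<and>
     (\<forall>x. 0 \<le> I x) \<and>
     (\<forall>a::real. compact {x. I x \<le> ereal a}) \<and>
     (\<forall>U\<in>sets borel.
        - (INF x\<in>interior U. I x)
          \<le> liminf (\<lambda>n. ereal (1 / real n) * elog (\<P>(\<omega> in M. X n \<omega> \<in> U))) \<and>
        limsup (\<lambda>n. ereal (1 / real n) * elog (\<P>(\<omega> in M. X n \<omega> \<in> U)))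
          \<le> - (INF x\<in>closure U. I x))"

definition log_mgf_rate :: "'a measure \<Rightarrow> (nat \<Rightarrow> 'a \<Rightarrow> real) \<Rightarrow> real \<Rightarrow> nat \<Rightarrow> real" where
  "log_mgf_rate M Z l n = 1 / real n * ln (\<integral>\<omega>. exp (l * Z n \<omega>) \<partial>M)"

definition pressure :: "'a measure \<Rightarrow> (nat \<Rightarrow> 'a \<Rightarrow> real) \<Rightarrow> real \<Rightarrow> real" where
  "pressure M Z l = lim (log_mgf_rate M Z l)"

definition legendre_transform :: "(real \<Rightarrow> real) \<Rightarrow> real \<Rightarrow> ereal" where
  "legendre_transform L x = (SUP l. ereal (l * x - L l))"

end

theory Submission
  imports Defs "HOL-Real_Asymp.Real_Asymp"
begin

text \<open>Put \<open>k = 1 / \<alpha>\<close>, \<open>x = e\<^sup>l\<close> and \<open>b\<^sub>n(x) = E x\<^bsup>Z\<^sub>n\<^sub>+\<^sub>1\<^esup>\<close>. The one-step law gives the recursion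
  \<open>b\<^sub>n\<^sub>+\<^sub>1 = x b\<^sub>n + k x (1 - x) b\<^sub>n' / (n + 1)\<close>, which for \<open>k = 1\<close> and \<open>k = 2\<close> (weighted counts of permutations
  by runs and by peaks) is equivalent to saying that \<open>B = \<Sum>b\<^sub>n t\<^sup>n\<close> solves the Riccati equation
  \<open>B' = B\<^sup>2 + p B + x\<close> with \<open>p = 1 + x\<close> or \<open>p = 2\<close>. Its solution blows up at
  \<open>R = \<integral>\<^sub>0\<^sup>\<infinity> dy / (y\<^sup>2 + p y + x) = \<integral>\<^sub>0\<^sup>1 du / (1 + (x - 1) u\<^sup>k)\<close>. Comparing partial sums with the flow
  bounds \<open>b\<^sub>n\<close> by \<open>C t\<^sup>-\<^sup>n\<close> for every \<open>t < R\<close>; conversely \<open>b\<^sub>m\<^sub>+\<^sub>n \<ge> c b\<^sub>m b\<^sub>n\<close>, so a single large term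
  \<open>b\<^sub>m t\<^sup>m\<close> with \<open>t > R\<close> forces \<open>b\<^sub>n \<ge> K t\<^sup>-\<^sup>n\<close>. Hence the pressure is \<open>- ln R\<close>, which is differentiable in
  \<open>l\<close>, and the large deviation principle is an instance of the Gaertner-Ellis theorem.\<close>

subsection \<open>Growth of Riccati sequences\<close>

text \<open>The coefficients of a power series solution of B' = B^2 + (e1 + e2) B + x with B(0) = 0.
  As \<open>b 0 = 0\<close>, the convolution has no terms with an empty left or right part. The
  linear term supplies them with weights \<open>e1\<close> and \<open>e2\<close>, which are kept
  apart because each belongs to one side in the supermultiplicativity argument.\<close>

locale riccati_sequence =
  fixes b :: "nat \<Rightarrow> real" and e1 e2 x :: real
  assumes x_pos: "x > 0" and e1_pos: "e1 > 0" and e2_pos: "e2 > 0"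
    and b_0: "b 0 = 0"
    and recursion: "\<And>n. real (Suc n) * b (Suc n) =
          (e1 + e2) * b n + (\<Sum>k\<le>n. b k * b (n - k)) + (if n = 0 then x else 0)"
begin

lemma b_1: "b (Suc 0) = x"
  using recursion[of 0] b_0 by simp

lemma nonneg: "b n \<ge> 0"
proof (induction n rule: less_induct)
  case (less n)
  show ?case
  proof (cases n)
    case 0
    then show ?thesis by (simp add: b_0)
  next
    case (Suc m)
    have "real (Suc m) * b (Suc m) \<ge> 0"
      unfolding recursion using less Suc x_pos e1_pos e2_pos
      by (intro add_nonneg_nonneg mult_nonneg_nonneg sum_nonneg) auto
    then show ?thesis using Suc by (simp add: zero_le_mult_iff)
  qed
qed

lemma pos: "n \<ge> 1 \<Longrightarrow> b n > 0"
proof (induction n rule: nat_induct_at_least)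
  case base
  then show ?case using b_1 x_pos by simp
next
  case (Suc n)
  have "(e1 + e2) * b n > 0" using Suc e1_pos e2_pos by simp
  moreover have "(\<Sum>k\<le>n. b k * b (n - k)) \<ge> 0" by (intro sum_nonneg mult_nonneg_nonneg nonneg)
  ultimately have "real (Suc n) * b (Suc n) > 0"
    unfolding recursion using x_pos Suc.hyps by simp
  then show ?case by (simp add: zero_less_mult_iff)
qed

text \<open>The recursion splits a permutation of \<open>m + n\<close> letters at its largest letter; when that letter
  lies among the first \<open>m\<close>, the induction hypothesis applies to what is on its right.\<close>
lemma supermultiplicative_half:
  assumes c: "c \<ge> 0" "c * f1 \<le> 1" "c * f2 \<le> 1" "c * x \<le> f1" and f: "f1 + f2 = e1 + e2" "f1 \<ge> 0"
    and m: "m \<ge> 1" and n: "n \<ge> 1"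
    and IH: "\<And>j. 1 \<le> j \<Longrightarrow> j < m \<Longrightarrow> b (j + n) \<ge> c * b j * b n"
  shows "f1 * b (m + n - 1) + (\<Sum>k<m. b k * b (m + n - 1 - k)) \<ge> c * real m * b m * b n"
proof -
  obtain l where l: "m = Suc l" using m by (cases m) auto
  show ?thesis
  proof (cases "l = 0")
    case True
    have "c * x * b n \<le> f1 * b n" using c nonneg by (intro mult_right_mono) auto
    then show ?thesis using True l b_0 b_1 by simp
  next
    case False
    \<comment> \<open>The three estimates treat an empty left part, a right part consisting of
      exactly the last \<open>n\<close> letters, and a right part that still contains letters of the
      first block. Only the second is free of the induction hypothesis and uses
      \<open>c * f2 \<le> 1\<close>.\<close>
    have 1: "f1 * b (l + n) \<ge> c * f1 * b l * b n"
      using mult_left_mono[OF IH[of l] f(2)] False l by (simp add: mult_ac)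
    have 2: "b l * b n \<ge> c * f2 * b l * b n"
      using mult_right_mono[OF c(3), of "b l * b n"] nonneg by (simp add: mult_ac)
    have 3: "(\<Sum>k<l. b k * b (l + n - k)) \<ge> (\<Sum>k<l. c * b n * (b k * b (l - k)))"
    proof (intro sum_mono)
      fix k assume k: "k \<in> {..<l}"
      have eq: "l + n - k = l - k + n" using k by simp
      show "c * b n * (b k * b (l - k)) \<le> b k * b (l + n - k)"
        unfolding eq
        using mult_left_mono[OF IH[of "l - k"] nonneg[of k]] k l by (simp add: mult_ac)
    qed
    have 4: "(\<Sum>k\<le>l. b k * b (l - k)) = (\<Sum>k<l. b k * b (l - k))"
      by (simp add: lessThan_Suc_atMost[symmetric] b_0)
    have "c * real m * b m * b n = c * b n * (real (Suc l) * b (Suc l))"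
      using l by simp
    also have "\<dots> = c * b n * ((f1 + f2) * b l + (\<Sum>k<l. b k * b (l - k)))"
      unfolding recursion f using False by (simp add: 4)
    also have "\<dots> = c * f1 * b l * b n + c * f2 * b l * b n + (\<Sum>k<l. c * b n * (b k * b (l - k)))"
      by (simp add: algebra_simps sum_distrib_left)
    also have "\<dots> \<le> f1 * b (l + n) + b l * b n + (\<Sum>k<l. b k * b (l + n - k))"
      using 1 2 3 by linarith
    also have "\<dots> = f1 * b (m + n - 1) + (\<Sum>k<m. b k * b (m + n - 1 - k))"
      using l by simp
    finally show ?thesis .
  qed
qed

text \<open>The largest letter lies among the first \<open>m\<close> or among the last
  \<open>n\<close> letters. The half lemma for \<open>(m, n)\<close> and its mirror image, with
  \<open>e1\<close> and \<open>e2\<close> exchanged, contribute \<open>m\<close> and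
  \<open>n\<close> copies of the product, which matches the factor \<open>m + n\<close> of the
  recursion.\<close>

lemma supermultiplicative:
  assumes c: "c \<ge> 0" "c * e1 \<le> 1" "c * e2 \<le> 1" "c * x \<le> e1" "c * x \<le> e2"
    and "m \<ge> 1" "n \<ge> 1"
  shows "b (m + n) \<ge> c * b m * b n"
  using assms(6,7)
proof (induction "m + n" arbitrary: m n rule: less_induct)
  case less
  define N where "N = m + n - 1"
  have N: "m + n = Suc N" "N \<noteq> 0" using less.prems by (auto simp: N_def)
  have 1: "e1 * b N + (\<Sum>k<m. b k * b (N - k)) \<ge> c * real m * b m * b n"
    unfolding N_def
    by (rule supermultiplicative_half[where ?f2.0 = e2]) (use c less e1_pos in auto)
  have "e2 * b (n + m - 1) + (\<Sum>k<n. b k * b (n + m - 1 - k)) \<ge> c * real n * b n * b m"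
    by (rule supermultiplicative_half[where ?f2.0 = e1])
       (use c less e2_pos in \<open>auto simp: add.commute\<close>)
  then have 2: "e2 * b N + (\<Sum>k<n. b k * b (N - k)) \<ge> c * real n * b n * b m"
    by (simp add: N_def add.commute)
  have "(\<Sum>k\<le>N. b k * b (N - k)) = (\<Sum>k<m. b k * b (N - k)) + (\<Sum>k\<in>{m..N}. b k * b (N - k))"
    by (subst sum.union_disjoint[symmetric]) (use less.prems N in \<open>auto intro!: sum.cong\<close>)
  also have "(\<Sum>k\<in>{m..N}. b k * b (N - k)) = (\<Sum>k<n. b k * b (N - k))"
    by (rule sum.reindex_bij_witness[of _ "\<lambda>k. N - k" "\<lambda>k. N - k"])
       (use less.prems N in auto)
  finally have "real (Suc N) * b (Suc N) \<ge> c * real m * b m * b n + c * real n * b n * b m"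
    unfolding recursion using 1 2 N by (simp add: algebra_simps)
  also have "c * real m * b m * b n + c * real n * b n * b m = real (Suc N) * (c * b m * b n)"
    unfolding N(1)[symmetric] by (simp add: algebra_simps)
  finally show ?case unfolding N(1) by (simp del: of_nat_Suc)
qed

lemma convolution_term:
  fixes t :: real
  shows "(\<Sum>k\<le>n. b k * b (n - k)) * t ^ n = (\<Sum>k\<le>n. (b k * t ^ k) * (b (n - k) * t ^ (n - k)))"
  unfolding sum_distrib_right
proof (intro sum.cong refl)
  fix k assume "k \<in> {..n}"
  then have "t ^ n = t ^ k * t ^ (n - k)" by (simp flip: power_add)
  then show "b k * b (n - k) * t ^ n = b k * t ^ k * (b (n - k) * t ^ (n - k))" by simp
qed

text \<open>A truncated solution is a subsolution: all terms are nonnegative, and the convolution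
  terms that occur in the derivative have index pairs in a triangle inside the square that gives
  \<open>S\<^sup>2\<close>.\<close>

lemma partial_sum_derivative_le:
  fixes t :: real and N :: nat
  assumes t: "t \<ge> 0"
  defines "S \<equiv> \<Sum>n\<le>N. b n * t ^ n"
  shows "(\<Sum>n<N. real (Suc n) * b (Suc n) * t ^ n) \<le> S\<^sup>2 + (e1 + e2) * S + x"
proof -
  have "(\<Sum>n<N. real (Suc n) * b (Suc n) * t ^ n) =
      (e1 + e2) * (\<Sum>n<N. b n * t ^ n) + (\<Sum>n<N. (\<Sum>k\<le>n. b k * b (n - k)) * t ^ n)
      + (\<Sum>n<N. (if n = 0 then x else 0) * t ^ n)"
    unfolding recursion by (simp add: algebra_simps sum.distrib sum_distrib_left)
  also have "(\<Sum>n<N. (if n = 0 then x else 0) * t ^ n) \<le> x"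
  proof -
    have "(\<Sum>n<N. (if n = 0 then x else 0) * t ^ n) = (\<Sum>n<N. if n = 0 then x else 0)"
      by (intro sum.cong) auto
    then show ?thesis using x_pos by (simp add: sum.delta)
  qed
  also have "(\<Sum>n<N. b n * t ^ n) \<le> S"
    unfolding S_def by (intro sum_mono2) (use nonneg t in auto)
  also have "(\<Sum>n<N. (\<Sum>k\<le>n. b k * b (n - k)) * t ^ n) \<le> S\<^sup>2"
  proof -
    have "(\<Sum>n<N. (\<Sum>k\<le>n. b k * b (n - k)) * t ^ n) =
          (\<Sum>n<N. \<Sum>k\<le>n. (b k * t ^ k) * (b (n - k) * t ^ (n - k)))"
      by (simp only: convolution_term)
    also have "\<dots> = (\<Sum>(i, j) | i + j < N. (b i * t ^ i) * (b j * t ^ j))"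
      by (rule sum.triangle_reindex[symmetric])
    also have "\<dots> \<le> (\<Sum>(i, j)\<in>{..N} \<times> {..N}. (b i * t ^ i) * (b j * t ^ j))"
      by (rule sum_mono2) (use nonneg t in auto)
    also have "\<dots> = S\<^sup>2"
      by (simp add: S_def power2_eq_square sum_product sum.cartesian_product)
    finally show ?thesis .
  qed
  finally show ?thesis using e1_pos e2_pos by (simp add: mult_left_mono)
qed

end

section \<open>Blow-up time of the flow and two-sided growth bounds\<close>

text \<open>Here \<open>\<Phi>\<close> is the time the Riccati flow started at 0 needs to reach a level, and \<open>R\<close> its
  blow-up time.\<close>
locale riccati_blowup = riccati_sequence +
  fixes \<Phi> :: "real \<Rightarrow> real" and R :: real
  assumes Phi_0: "\<Phi> 0 = 0"
    and Phi_deriv: "\<And>y. y \<ge> 0 \<Longrightarrow>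
          (\<Phi> has_real_derivative 1 / (y\<^sup>2 + (e1 + e2) * y + x)) (at y within {0..})"
    and Phi_less: "\<And>y. y \<ge> 0 \<Longrightarrow> \<Phi> y < R"
    and Phi_lim: "(\<Phi> \<longlongrightarrow> R) at_top"
begin

lemma quad_pos: "y \<ge> 0 \<Longrightarrow> y\<^sup>2 + (e1 + e2) * y + x > 0"
  using x_pos e1_pos e2_pos by (intro add_nonneg_pos add_nonneg_nonneg mult_nonneg_nonneg) auto

lemma Phi_DERIV:
  assumes "y > 0"
  shows "DERIV \<Phi> y :> 1 / (y\<^sup>2 + (e1 + e2) * y + x)"
  using Phi_deriv[of y] assms at_within_interior[of y "{0..}"] by simp

lemma continuous_on_Phi: "continuous_on {0..} \<Phi>"
  by (rule DERIV_continuous_on[of "{0..}" \<Phi>]) (auto intro: Phi_deriv)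

lemma Phi_mono:
  assumes "0 \<le> y" "y \<le> z"
  shows "\<Phi> y \<le> \<Phi> z"
  using assms(2)
proof (rule DERIV_nonneg_imp_increasing_open)
  fix w assume "y < w" "w < z"
  then show "\<exists>d. DERIV \<Phi> w :> d \<and> d \<ge> 0"
    using Phi_DERIV[of w] quad_pos[of w] assms by (intro exI[of _ "1 / (w\<^sup>2 + (e1 + e2) * w + x)"]) auto
qed (rule continuous_on_subset[OF continuous_on_Phi], use assms in auto)

text \<open>Because \<open>S\<close> is a subsolution, \<open>u - \<Phi> (S u)\<close> has
  nonnegative derivative and starts at 0. The case \<open>N = 0\<close> is separate because the
  two-sided derivative of \<open>\<Phi>\<close> requires \<open>S u > 0\<close>.\<close>

lemma partial_sum_bound:
  assumes "t \<ge> 0"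
  shows "\<Phi> (\<Sum>n\<le>N. b n * t ^ n) \<le> t"
proof -
  define S where "S t = (\<Sum>n\<le>N. b n * t ^ n)" for t
  define S' where "S' t = (\<Sum>n<N. real (Suc n) * b (Suc n) * t ^ n)" for t
  have S_nonneg: "S t \<ge> 0" if "t \<ge> 0" for t
    unfolding S_def using nonneg that by (intro sum_nonneg) auto
  have S_DERIV: "DERIV S t :> S' t" for t
  proof -
    have "DERIV S t :> (\<Sum>n\<le>N. b n * (real n * t ^ (n - 1)))"
      unfolding S_def by (auto intro!: derivative_eq_intros sum.cong)
    also have "(\<Sum>n\<le>N. b n * (real n * t ^ (n - 1))) = S' t"
      unfolding S'_def by (subst sum.atMost_shift) (auto intro!: sum.cong)
    finally show ?thesis .
  qed
  have S_pos: "S t > 0" if "t > 0" "N \<noteq> 0" for t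
  proof -
    have "0 < b 1 * t ^ 1" using pos[of 1] that by simp
    also have "\<dots> \<le> S t" unfolding S_def
      by (rule member_le_sum) (use that nonneg in auto)
    finally show ?thesis .
  qed
  have S_0: "S 0 = 0" unfolding S_def by (auto simp: power_0_left b_0 intro!: sum.neutral)
  show ?thesis
  proof (cases "N = 0")
    case True
    then show ?thesis using assms by (simp add: b_0 Phi_0)
  next
    case False
    have "0 - \<Phi> (S 0) \<le> t - \<Phi> (S t)"
      using assms
    proof (rule DERIV_nonneg_imp_increasing_open)
      fix u assume u: "0 < u" "u < t"
      let ?q = "(S u)\<^sup>2 + (e1 + e2) * S u + x"
      have "DERIV (\<lambda>u. u - \<Phi> (S u)) u :> 1 - 1 / ?q * S' u"
        using S_pos u False by (intro DERIV_diff DERIV_ident DERIV_chain2[OF Phi_DERIV S_DERIV]) auto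
      moreover have "S' u \<le> ?q"
        using partial_sum_derivative_le[of u N] u unfolding S_def S'_def by simp
      then have "1 - 1 / ?q * S' u \<ge> 0" using quad_pos[of "S u"] S_nonneg u by (simp add: field_simps)
      ultimately show "\<exists>y. DERIV (\<lambda>u. u - \<Phi> (S u)) u :> y \<and> y \<ge> 0" by blast
    next
      have "continuous_on {0..t} S"
        by (rule DERIV_continuous_on[of _ S S']) (rule has_field_derivative_at_within[OF S_DERIV])
      moreover have "S ` {0..t} \<subseteq> {0..}" by (rule image_subsetI) (simp add: S_nonneg)
      ultimately show "continuous_on {0..t} (\<lambda>u. u - \<Phi> (S u))"
        by (intro continuous_intros continuous_on_compose2[OF continuous_on_Phi])
    qed
    then have "\<Phi> (S t) \<le> t" unfolding S_0 Phi_0 by simp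
    then show ?thesis unfolding S_def .
  qed
qed

lemma upper_growth:
  assumes "0 < t" "t < R"
  shows "\<exists>C>0. \<forall>n. b n \<le> C / t ^ n"
proof -
  have "eventually (\<lambda>y. \<Phi> y > t \<and> y > 0) at_top"
    using order_tendstoD(1)[OF Phi_lim assms(2)] eventually_gt_at_top[of 0] by eventually_elim auto
  then obtain Y where Y: "\<Phi> Y > t" "Y > 0" using eventually_happens by fastforce
  have "b n \<le> Y / t ^ n" for n
  proof -
    have "b n * t ^ n \<le> (\<Sum>k\<le>n. b k * t ^ k)"
      by (rule member_le_sum[where f = "\<lambda>k. b k * t ^ k"]) (use assms nonneg in auto)
    also have "\<dots> \<le> Y"
    proof (rule ccontr)
      assume "\<not> \<dots> \<le> Y"
      then have "\<Phi> Y \<le> \<Phi> (\<Sum>k\<le>n. b k * t ^ k)" using Y by (intro Phi_mono) auto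
      then show False using partial_sum_bound[of t n] Y assms by linarith
    qed
    finally show ?thesis using assms by (simp add: field_simps)
  qed
  then show ?thesis using Y by blast
qed

text \<open>Inside its disc of convergence the generating function solves the Riccati equation, so it
  cannot be finite past the blow-up time.\<close>
lemma terms_unbounded:
  assumes t: "t > R"
  shows "\<exists>m. b m * t ^ m > C"
proof (rule ccontr)
  assume "\<not> ?thesis"
  then have bdd: "b m * t ^ m \<le> C" for m by (meson not_le)
  have R: "R > 0" using Phi_less[of 0] Phi_0 by simp
  \<comment> \<open>A time strictly between blow-up and \<open>t\<close>: bounded terms at
    \<open>t\<close> make the series converge at \<open>y\<close>.\<close>
  define y where "y = (R + t) / 2"
  have y: "R < y" "y < t" "0 < y" using t R by (auto simp: y_def)
  have summ: "summable (\<lambda>n. b n * u ^ n)" if u: "0 \<le> u" "u < t" for u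
  proof (rule summable_comparison_test')
    show "summable (\<lambda>n. C * (u / t) ^ n)"
      using u by (intro summable_mult summable_geometric) auto
    fix n
    have "b n * u ^ n = b n * t ^ n * (u / t) ^ n" using y t R by (simp add: power_divide)
    also have "\<dots> \<le> C * (u / t) ^ n" using u bdd by (intro mult_right_mono) auto
    finally show "norm (b n * u ^ n) \<le> C * (u / t) ^ n" using nonneg u by simp
  qed
  define B where "B u = (\<Sum>n. b n * u ^ n)" for u
  have B_nonneg: "B u \<ge> 0" if "0 \<le> u" "u < t" for u
    unfolding B_def using that nonneg by (intro suminf_nonneg summ) auto
  have B_pos: "B u > 0" if "0 < u" "u < t" for u
    unfolding B_def using that nonneg pos[of 1]
    by (intro suminf_pos2[where i = 1] summ) auto
  have B_0: "B 0 = 0" unfolding B_def by (subst powser_zero) (rule b_0)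
  have B_DERIV: "DERIV B u :> (B u)\<^sup>2 + (e1 + e2) * B u + x" if u: "0 \<le> u" "u < t" for u
  proof -
    have "DERIV B u :> (\<Sum>n. diffs b n * u ^ n)"
      unfolding B_def
      by (rule termdiffs_strong[OF summ[of "(u + t) / 2"]]) (use u in auto)
    also have "(\<Sum>n. diffs b n * u ^ n) = (B u)\<^sup>2 + (e1 + e2) * B u + x"
    proof (rule sums_unique[symmetric])
      have s: "(\<lambda>n. b n * u ^ n) sums B u" unfolding B_def using summ[OF u] by (simp add: summable_sums)
      have a: "summable (\<lambda>n. norm (b n * u ^ n))" using summ[OF u] nonneg u by (simp add: abs_mult)
      have 1: "(\<lambda>n. \<Sum>k\<le>n. (b k * u ^ k) * (b (n - k) * u ^ (n - k))) sums (B u * B u)"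
        using Cauchy_product_sums[OF a a] by (simp add: B_def)
      have 2: "(\<lambda>n. if n = 0 then x else 0) sums x"
        using sums_single[of 0 "\<lambda>_. x"] by simp
      have "(\<lambda>n. (\<Sum>k\<le>n. (b k * u ^ k) * (b (n - k) * u ^ (n - k))) + (e1 + e2) * (b n * u ^ n)
              + (if n = 0 then x else 0)) sums (B u * B u + (e1 + e2) * B u + x)"
        by (intro sums_add 1 2 sums_mult s)
      also have "(\<lambda>n. (\<Sum>k\<le>n. (b k * u ^ k) * (b (n - k) * u ^ (n - k))) + (e1 + e2) * (b n * u ^ n)
              + (if n = 0 then x else 0)) = (\<lambda>n. diffs b n * u ^ n)"
      proof
        fix n
        have "(\<Sum>k\<le>n. (b k * u ^ k) * (b (n - k) * u ^ (n - k))) = (\<Sum>k\<le>n. b k * b (n - k)) * u ^ n"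
          by (simp only: convolution_term)
        then show "(\<Sum>k\<le>n. (b k * u ^ k) * (b (n - k) * u ^ (n - k))) + (e1 + e2) * (b n * u ^ n)
              + (if n = 0 then x else 0) = diffs b n * u ^ n"
          unfolding diffs_def recursion by (auto simp: algebra_simps)
      qed
      finally show "(\<lambda>n. diffs b n * u ^ n) sums ((B u)\<^sup>2 + (e1 + e2) * B u + x)"
        by (simp add: power2_eq_square)
    qed
    finally show ?thesis .
  qed
  \<comment> \<open>Along a solution \<open>\<Phi>\<close> measures elapsed time, so
    \<open>\<Phi> (B y) = y > R\<close>, whereas \<open>\<Phi>\<close> stays below
    \<open>R\<close>.\<close>
  have "\<Phi> (B y) - y = \<Phi> (B 0) - 0"
  proof (rule DERIV_isconst_end[of 0 y "\<lambda>u. \<Phi> (B u) - u"])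
    have "continuous_on {0..y} B"
      by (rule DERIV_continuous_on[of _ B]) (rule has_field_derivative_at_within[OF B_DERIV], use y in auto)
    moreover have "B ` {0..y} \<subseteq> {0..}" using B_nonneg y by auto
    ultimately show "continuous_on {0..y} (\<lambda>u. \<Phi> (B u) - u)"
      by (intro continuous_intros continuous_on_compose2[OF continuous_on_Phi])
    fix u assume u: "0 < u" "u < y"
    let ?q = "(B u)\<^sup>2 + (e1 + e2) * B u + x"
    have "DERIV (\<lambda>u. \<Phi> (B u) - u) u :> 1 / ?q * ?q - 1"
      using B_pos u y
      by (intro DERIV_diff DERIV_ident DERIV_chain2[OF Phi_DERIV B_DERIV]) auto
    moreover have "?q > 0" using quad_pos[of "B u"] B_pos[of u] u y by simp
    ultimately show "DERIV (\<lambda>u. \<Phi> (B u) - u) u :> 0" by simp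
  qed (use y in auto)
  then show False using Phi_less[OF B_nonneg[of y]] y by (simp add: B_0 Phi_0)
qed

text \<open>Once \<open>c * b m \<ge> 1 / t ^ m\<close>, supermultiplicativity carries a bound
  \<open>K / t ^ n\<close> from \<open>n - m\<close> to \<open>n\<close>. The constant
  \<open>K\<close> is the worst case over the first block of \<open>m\<close> indices.\<close>

lemma lower_growth:
  assumes c: "c > 0" "c * e1 \<le> 1" "c * e2 \<le> 1" "c * x \<le> e1" "c * x \<le> e2"
    and t: "t > R"
  shows "\<exists>K>0. \<forall>n\<ge>1. b n \<ge> K / t ^ n"
proof -
  have tpos: "t > 0" using Phi_less[of 0] Phi_0 t by simp
  obtain m where m: "b m * t ^ m > 1 / c" using terms_unbounded[OF t] by blast
  have m0: "m \<ge> 1"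
  proof (rule ccontr)
    assume "\<not> m \<ge> 1"
    then have "m = 0" by simp
    then have "1 / c < 0" using m b_0 by simp
    then show False using c(1) by (simp add: divide_less_0_iff)
  qed
  have m': "c * b m \<ge> 1 / t ^ m" 
  proof -
    have "1 < b m * t ^ m * c" using m c(1) by (simp only: pos_divide_less_eq)
    then have "1 \<le> c * b m * t ^ m" by (simp only: mult_ac)
    then show ?thesis using tpos by (simp only: pos_divide_le_eq zero_less_power)
  qed
  define K where "K = Min ((\<lambda>r. b r * t ^ r) ` {1..m})"
  have K: "K > 0" unfolding K_def using m0 pos tpos by (subst Min_gr_iff) auto
  have "b n \<ge> K / t ^ n" if "n \<ge> 1" for n
    using that
  proof (induction n rule: less_induct)
    case (less n)
    show ?case
    proof (cases "n \<le> m")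
      case True
      then have "K \<le> b n * t ^ n" unfolding K_def using less by (intro Min_le) auto
      then show ?thesis using tpos by (simp add: field_simps)
    next
      case False
      have "t ^ n = t ^ m * t ^ (n - m)" using False by (simp flip: power_add)
      then have "K / t ^ n = 1 / t ^ m * (K / t ^ (n - m))" by simp
      also have "\<dots> \<le> c * b m * b (n - m)"
        using less False m0 m' K tpos c nonneg by (intro mult_mono) auto
      also have "\<dots> \<le> b (m + (n - m))"
        using False m0 c by (intro supermultiplicative) auto
      finally show ?thesis using False by simp
    qed
  qed
  then show ?thesis using K by blast
qed

lemma growth_rate:
  assumes c: "c > 0" "c * e1 \<le> 1" "c * e2 \<le> 1" "c * x \<le> e1" "c * x \<le> e2"
  shows "(\<lambda>n. ln (b n) / real n) \<longlonglongrightarrow> - ln R"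
proof (rule order_tendstoI)
  have R: "R > 0" using Phi_less[of 0] Phi_0 by simp
  fix a assume a: "a < - ln R"
  \<comment> \<open>Half of the gap is spent on moving from \<open>R\<close> to \<open>t\<close>,
    the other half on absorbing \<open>ln K / n\<close>.\<close>
  define d where "d = (- ln R - a) / 2"
  define t where "t = R * exp d"
  have d: "d > 0" "2 * d = - ln R - a" using a by (simp_all add: d_def)
  have "t > R" using R d by (simp add: t_def)
  then obtain K where K: "K > 0" "\<And>n. n \<ge> 1 \<Longrightarrow> b n \<ge> K / t ^ n" using lower_growth[OF c] by blast
  have tpos: "t > 0" using R by (simp add: t_def)
  have lt: "ln t = ln R + d" using R by (simp add: t_def ln_mult)
  have "(\<lambda>n. ln K / real n) \<longlonglongrightarrow> 0" by real_asymp
  then have "eventually (\<lambda>n. ln K / real n > - d) sequentially" using d by (intro order_tendstoD) auto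
  then show "eventually (\<lambda>n. a < ln (b n) / real n) sequentially"
    using eventually_ge_at_top[of 1]
  proof eventually_elim
    case (elim n)
    have "ln (K / t ^ n) \<le> ln (b n)" using K elim tpos pos by (subst ln_le_cancel_iff) auto
    then have "ln K - real n * ln t \<le> ln (b n)" using K tpos by (simp add: ln_div ln_realpow)
    then have "(ln K - real n * ln t) / real n \<le> ln (b n) / real n" by (rule divide_right_mono) simp
    then have "ln K / real n - ln t \<le> ln (b n) / real n" using elim by (simp add: diff_divide_distrib)
    then show ?case using elim(1) lt d(2) by linarith
  qed
next
  have R: "R > 0" using Phi_less[of 0] Phi_0 by simp
  fix a assume a: "a > - ln R"
  define d where "d = (a + ln R) / 2"
  define t where "t = R * exp (- d)"
  have d: "d > 0" "2 * d = a + ln R" using a by (simp_all add: d_def)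
  have "t < R" using R d by (simp add: t_def)
  moreover have tpos: "t > 0" using R by (simp add: t_def)
  ultimately obtain K where K: "K > 0" "\<And>n. b n \<le> K / t ^ n" using upper_growth by blast
  have lt: "ln t = ln R - d" using R by (simp add: t_def ln_mult)
  have "(\<lambda>n. ln K / real n) \<longlonglongrightarrow> 0" by real_asymp
  then have "eventually (\<lambda>n. ln K / real n < d) sequentially" using d by (intro order_tendstoD) auto
  then show "eventually (\<lambda>n. ln (b n) / real n < a) sequentially"
    using eventually_ge_at_top[of 1]
  proof eventually_elim
    case (elim n)
    have "ln (b n) \<le> ln (K / t ^ n)" using K elim tpos pos by (subst ln_le_cancel_iff) auto
    then have "ln (b n) \<le> ln K - real n * ln t" using K tpos by (simp add: ln_div ln_realpow)
    then have "ln (b n) / real n \<le> (ln K - real n * ln t) / real n" by (rule divide_right_mono) simp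
    then have "ln (b n) / real n \<le> ln K / real n - ln t" using elim by (simp add: diff_divide_distrib)
    then show ?case using elim(1) lt d(2) by linarith
  qed
qed

end

subsection \<open>From linear to convolution recursions\<close>

text \<open>The coefficient form of 2 B (t B') = t (B^2)'.\<close>

lemma sum_convolution_symmetric:
  fixes r :: "nat \<Rightarrow> 'a::comm_ring_1"
  shows "2 * (\<Sum>k\<le>N. of_nat (N - k) * (r k * r (N - k))) = of_nat N * (\<Sum>k\<le>N. r k * r (N - k))"
proof -
  have "(\<Sum>k\<le>N. of_nat (N - k) * (r k * r (N - k))) = (\<Sum>k\<le>N. of_nat k * (r k * r (N - k)))"
    by (rule sum.reindex_bij_witness[of _ "\<lambda>k. N - k" "\<lambda>k. N - k"]) (auto simp: mult.commute)
  then have "2 * (\<Sum>k\<le>N. of_nat (N - k) * (r k * r (N - k))) =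
      (\<Sum>k\<le>N. of_nat (N - k) * (r k * r (N - k))) + (\<Sum>k\<le>N. of_nat k * (r k * r (N - k)))"
    by simp
  also have "\<dots> = (\<Sum>k\<le>N. (of_nat (N - k) + of_nat k) * (r k * r (N - k)))"
    by (simp only: sum.distrib distrib_right)
  also have "\<dots> = (\<Sum>k\<le>N. of_nat N * (r k * r (N - k)))"
    by (intro sum.cong refl) (simp flip: of_nat_add)
  finally show ?thesis by (simp add: sum_distrib_left)
qed

text \<open>In terms of \<open>B = \<Sum>r\<^sub>n t\<^sup>n\<close> the linear recursion is \<open>(1 - X t) B' = X + X B + D B\<close>, a transport
  equation solved by the flow \<open>B' = B\<^sup>2 + P B + X\<close>; applying \<open>D\<close> to the latter preserves it exactly when
  \<open>D P = (2 - P) X\<close>.\<close>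
lemma riccati_recursion_from_derivation:
  fixes r :: "nat \<Rightarrow> 'a::{idom,ring_char_0}" and D :: "'a \<Rightarrow> 'a"
  assumes D_add: "\<And>a b. D (a + b) = D a + D b"
    and D_mult: "\<And>a b. D (a * b) = D a * b + a * D b"
    and D_P: "D P = (2 - P) * X" and D_X: "D X = P * X - 2 * X * X"
    and r_0: "r 0 = 0" and r_1: "r (Suc 0) = X"
    and linear: "\<And>n. n \<ge> 1 \<Longrightarrow> of_nat (Suc n) * r (Suc n) = of_nat (Suc n) * X * r n + D (r n)"
  shows "of_nat (Suc n) * r (Suc n) =
          P * r n + (\<Sum>k\<le>n. r k * r (n - k)) + (if n = 0 then X else 0)"
proof -
  have D_0: "D 0 = 0" using D_add[of 0 0] by simp
  have D_of_nat: "D (of_nat m * a) = of_nat m * D a" for m a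
    by (induction m) (simp_all add: D_0 D_add algebra_simps)
  have D_sum: "D (\<Sum>i\<le>m. f i) = (\<Sum>i\<le>m. D (f i))" for f and m :: nat
    by (induction m) (simp_all add: D_add)
  \<comment> \<open>The linear recursion solved for \<open>D (r j)\<close>. It is assumed only from
    index 1 on; the correction makes the formula true at \<open>j = 0\<close> as well.\<close>
  have D_r: "D (r j) = of_nat (Suc j) * r (Suc j) - of_nat (Suc j) * (X * r j) - (if j = 0 then X else 0)" for j
    using linear[of j] r_0 r_1 D_0 by (cases "j = 0") (simp_all add: algebra_simps)
  show ?thesis
  proof (induction n)
    case 0
    then show ?case by (simp add: r_0 r_1)
  next
    case (Suc m)
    define n where "n = Suc m"
    show ?case
    proof (cases "m = 0")
      case True
      \<comment> \<open>The inhomogeneous term is still present in the hypothesis for index 0, so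
        this step is checked directly; it is where the value of \<open>D X\<close> enters.\<close>
      then show ?thesis using linear[of 1] r_0 r_1 D_X by (simp add: algebra_simps)
    next
      case False
      define A where "A = (\<Sum>k\<le>n. r k * r (n - k))"
      define A' where "A' = (\<Sum>k\<le>m. r k * r (m - k))"
      have IH: "of_nat n * r n = P * r m + A'" using Suc False by (simp add: n_def A'_def)
      have "D A' = (\<Sum>k\<le>m. D (r k) * r (m - k)) + (\<Sum>k\<le>m. r k * D (r (m - k)))"
        unfolding A'_def by (simp add: D_sum D_mult sum.distrib)
      also have "(\<Sum>k\<le>m. D (r k) * r (m - k)) = (\<Sum>k\<le>m. r k * D (r (m - k)))"
        by (rule sum.reindex_bij_witness[of _ "\<lambda>k. m - k" "\<lambda>k. m - k"]) (auto simp: mult.commute)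
      also have "(\<Sum>k\<le>m. r k * D (r (m - k))) =
          (\<Sum>k\<le>m. of_nat (n - k) * (r k * r (n - k))) - X * (\<Sum>k\<le>m. of_nat (m - k) * (r k * r (m - k)))
            - X * A' - (\<Sum>k\<le>m. if k = m then X * r m else 0)"
        unfolding D_r A'_def sum_distrib_left sum_subtractf[symmetric]
        by (intro sum.cong refl) (auto simp: n_def Suc_diff_le algebra_simps)
      also have "(\<Sum>k\<le>m. if k = m then X * r m else 0) = X * r m" by simp
      also have "(\<Sum>k\<le>m. of_nat (n - k) * (r k * r (n - k))) = (\<Sum>k\<le>n. of_nat (n - k) * (r k * r (n - k)))"
        by (simp add: n_def)
      finally have "D A' = 2 * (\<Sum>k\<le>n. of_nat (n - k) * (r k * r (n - k)))
          - X * (2 * (\<Sum>k\<le>m. of_nat (m - k) * (r k * r (m - k)))) - 2 * (X * A') - 2 * (X * r m)"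
        by (simp add: algebra_simps)
      also have "\<dots> = of_nat n * A - X * (of_nat m * A') - 2 * (X * A') - 2 * (X * r m)"
        unfolding sum_convolution_symmetric A_def A'_def ..
      finally have DA: "D A' = of_nat n * A - of_nat (Suc n) * (X * A') - 2 * (X * r m)"
        by (simp add: n_def algebra_simps)
      \<comment> \<open>\<open>D\<close> is applied to the recursion at \<open>m\<close>. The term
        \<open>2 * X * r m\<close> from \<open>D P\<close> cancels the boundary term of
        \<open>D A'\<close>, and the rest regroups into the induction hypothesis, so that the factor
        \<open>n\<close> can be cancelled.\<close>
      have "of_nat n * D (r n) = D (of_nat n * r n)" by (rule D_of_nat[symmetric])
      also have "\<dots> = D P * r m + P * D (r m) + D A'" unfolding IH by (simp add: D_add D_mult)
      also have "\<dots> = P * (of_nat n * r n) + of_nat n * A - of_nat (Suc n) * (X * (P * r m + A'))"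
        unfolding D_P D_r DA using False by (simp add: n_def algebra_simps)
      also have "\<dots> = of_nat n * (P * r n + A - of_nat (Suc n) * (X * r n))"
        unfolding IH[symmetric] by (simp add: algebra_simps)
      finally have "D (r n) = P * r n + A - of_nat (Suc n) * (X * r n)"
        by (simp add: n_def del: of_nat_Suc)
      then have "of_nat (Suc n) * r (Suc n) = P * r n + A"
        using linear[of n] by (simp add: n_def algebra_simps)
      then show ?thesis by (simp add: A_def n_def)
    qed
  qed
qed

subsection \<open>The generating polynomials of the chain\<close>

text \<open>\<open>chain_poly k n\<close> turns out to be the generating polynomial of \<open>Z\<^sub>n\<^sub>+\<^sub>1\<close>, where \<open>k = 1 / \<alpha>\<close>.\<close>
fun chain_poly :: "nat \<Rightarrow> nat \<Rightarrow> real poly" where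
  "chain_poly k 0 = 0"
| "chain_poly k (Suc n) = (if n = 0 then [:0, 1:] else [:0, 1:] * chain_poly k n
      + smult (real k / real (Suc n)) ([:0, 1, -1:] * pderiv (chain_poly k n)))"

text \<open>Written in the shape of the one-step law at time \<open>Suc n\<close>: staying at
  \<open>j\<close> or moving up from \<open>j - 1\<close>. This lets the law of the chain be matched
  by induction.\<close>

lemma coeff_chain_poly_Suc:
  assumes "n \<ge> 1"
  shows "coeff (chain_poly k (Suc n)) j =
     coeff (chain_poly k n) j * (real k * real j / real (Suc n)) +
     (if j = 0 then 0 else coeff (chain_poly k n) (j - 1) * (1 - real k * real (j - 1) / real (Suc n)))"
proof -
  have "[:0, 1, -1:] * q = pCons 0 (q - pCons 0 q)" for q :: "real poly" by (simp add: algebra_simps)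
  then show ?thesis using assms
    by (cases j; cases "j - 1") (auto simp: coeff_pderiv field_simps simp del: of_nat_Suc)
qed

text \<open>The derivation is D = k x (1 - x) d/dx. The condition on D X forces P = k + (2 - k) x,
  and the condition on D P then reads k (2 - k) = 2 - k, which singles out k = 1 and k = 2.\<close>

lemma chain_poly_recursion:
  assumes k: "k \<in> {1, 2}"
  shows "real (Suc n) * poly (chain_poly k (Suc n)) x =
     (1 + (if k = 1 then x else 1)) * poly (chain_poly k n) x
     + (\<Sum>j\<le>n. poly (chain_poly k j) x * poly (chain_poly k (n - j)) x) + (if n = 0 then x else 0)"
proof -
  define P :: "real poly" where "P = (if k = 1 then [:1, 1:] else [:2:])"
  define D :: "real poly \<Rightarrow> real poly" where "D p = [:0, real k, - real k:] * pderiv p" for p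
  have two: "2 = [:2 :: real:]" by (metis numeral_poly)
  have "of_nat (Suc n) * chain_poly k (Suc n) = P * chain_poly k n
      + (\<Sum>j\<le>n. chain_poly k j * chain_poly k (n - j)) + (if n = 0 then [:0, 1:] else 0)"
  proof (rule riccati_recursion_from_derivation[where D = D])
    show "D P = (2 - P) * [:0, 1:]"
      using k by (auto simp: D_def P_def pderiv_pCons two)
    show "D [:0, 1:] = P * [:0, 1:] - 2 * [:0, 1:] * [:0, 1:]"
      using k by (auto simp: D_def P_def pderiv_pCons two)
    fix m :: nat assume m: "m \<ge> 1"
    have scale: "of_nat (Suc m) * smult (real k / real (Suc m)) ([:0, 1, -1:] * q) = [:0, real k, - real k:] * q" for q
      by (simp add: of_nat_poly smult_add_right del: of_nat_Suc)
    have step: "chain_poly k (Suc m) = [:0, 1:] * chain_poly k m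
        + smult (real k / real (Suc m)) ([:0, 1, -1:] * pderiv (chain_poly k m))"
      using m by simp
    show "of_nat (Suc m) * chain_poly k (Suc m) =
        of_nat (Suc m) * [:0, 1:] * chain_poly k m + D (chain_poly k m)"
      unfolding step D_def distrib_left scale mult.assoc ..
  next
    show "D (a + b) = D a + D b" for a b unfolding D_def pderiv_add by (rule distrib_left)
    show "D (a * b) = D a * b + a * D b" for a b
      unfolding D_def pderiv_mult by (simp only: distrib_left distrib_right mult_ac add_ac)
  qed simp_all
  from arg_cong[OF this, of "\<lambda>p. poly p x"] show ?thesis
    by (cases "k = 1"; cases "n = 0")
       (simp_all add: P_def poly_sum of_nat_poly distrib_right del: chain_poly.simps(2) of_nat_Suc)
qed

subsection \<open>The blow-up time\<close>

text \<open>The upper limit is a variable because the integral serves as an antiderivative in two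
  substitutions: for the Riccati flow and for the integral in the pressure formula.\<close>

definition blowup_integral :: "nat \<Rightarrow> real \<Rightarrow> real \<Rightarrow> real" where
  "blowup_integral k x z = integral {0..z} (\<lambda>u. 1 / (1 + (x - 1) * u ^ k))"

text \<open>The denominator is the convex combination (1 - u^k) + x u^k of 1 and x.\<close>

lemma blowup_denominator_pos:
  fixes x u :: real
  assumes "x > 0" "0 \<le> u" "u \<le> 1"
  shows "1 + (x - 1) * u ^ k > 0"
proof (cases "u ^ k = 1")
  case False
  then have "u ^ k < 1" using assms power_le_one[of u k] by linarith
  moreover have "x * u ^ k \<ge> 0" using assms by simp
  ultimately show ?thesis by (simp add: algebra_simps)
qed (use assms in simp)

lemma continuous_on_blowup_integrand:
  assumes "x > 0"
  shows "continuous_on {0..1} (\<lambda>u::real. 1 / (1 + (x - 1) * u ^ k))"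
  using blowup_denominator_pos[OF assms] by (intro continuous_intros) (metis atLeastAtMost_iff less_irrefl)

lemma blowup_integral_0 [simp]: "blowup_integral k x 0 = 0"
  by (simp add: blowup_integral_def)

lemma blowup_integral_deriv:
  assumes "x > 0" "0 \<le> z" "z \<le> 1"
  shows "(blowup_integral k x has_real_derivative 1 / (1 + (x - 1) * z ^ k)) (at z within {0..1})"
  unfolding blowup_integral_def
  using integral_has_real_derivative[OF continuous_on_blowup_integrand[OF assms(1)]] assms by simp

lemma continuous_on_blowup_integral:
  assumes "x > 0"
  shows "continuous_on {0..1} (blowup_integral k x)"
  by (rule DERIV_continuous_on) (use blowup_integral_deriv[OF assms] in auto)

lemma blowup_integral_pos:
  assumes "x > 0" "0 < z" "z \<le> 1"
  shows "blowup_integral k x z > 0"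
proof -
  have "blowup_integral k x 0 < blowup_integral k x z"
    using assms(2)
  proof (rule DERIV_pos_imp_increasing_open)
    fix u assume u: "0 < u" "u < z"
    then have "DERIV (blowup_integral k x) u :> 1 / (1 + (x - 1) * u ^ k)"
      using blowup_integral_deriv[of x u k] assms at_within_interior[of u "{0..1}"] by simp
    then show "\<exists>y. DERIV (blowup_integral k x) u :> y \<and> 0 < y"
      using blowup_denominator_pos[of x u k] u assms
      by (intro exI[of _ "1 / (1 + (x - 1) * u ^ k)"]) auto
  next
    show "continuous_on {0..z} (blowup_integral k x)"
      by (rule continuous_on_subset[OF continuous_on_blowup_integral]) (use assms in auto)
  qed
  then show ?thesis by simp
qed

lemma blowup_integral_1 [simp]: "blowup_integral k 1 1 = 1"
  by (simp add: blowup_integral_def)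

text \<open>The substitution \<open>u = 1 / (y + 1)\<close> turns \<open>\<integral> dy / (y\<^sup>2 + p y + x)\<close> into the blow-up integral.\<close>
lemma riccati_blowup_chain_poly:
  assumes x: "x > 0" and k: "k \<in> {1, 2}"
  shows "riccati_blowup (\<lambda>n. poly (chain_poly k n) x) 1 (if k = 1 then x else 1) x
           (\<lambda>y. blowup_integral k x 1 - blowup_integral k x (1 / (y + 1))) (blowup_integral k x 1)"
proof unfold_locales
  fix n show "real (Suc n) * poly (chain_poly k (Suc n)) x =
      (1 + (if k = 1 then x else 1)) * poly (chain_poly k n) x
     + (\<Sum>j\<le>n. poly (chain_poly k j) x * poly (chain_poly k (n - j)) x) + (if n = 0 then x else 0)"
    by (rule chain_poly_recursion[OF k])
next
  fix y :: real assume y: "y \<ge> 0"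
  define z where "z = 1 / (y + 1)"
  have z: "0 < z" "z \<le> 1" using y by (auto simp: z_def)
  let ?d = "1 + (x - 1) * z ^ k"
  have d: "?d > 0" using blowup_denominator_pos[of x z k] z x by simp
  have "((\<lambda>y. 1 / (y + 1)) has_real_derivative - 1 / (y + 1)\<^sup>2) (at y within {0..})"
    using y by (auto intro!: derivative_eq_intros simp: power2_eq_square)
  moreover have "(blowup_integral k x has_real_derivative 1 / ?d)
      (at (1 / (y + 1)) within ((\<lambda>y. 1 / (y + 1)) ` {0..}))"
    unfolding z_def[symmetric]
    by (rule DERIV_subset[OF blowup_integral_deriv]) (use x z in auto)
  ultimately have "((\<lambda>y. blowup_integral k x (1 / (y + 1))) has_real_derivative
      1 / ?d * (- 1 / (y + 1)\<^sup>2)) (at y within {0..})"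
    by (intro DERIV_image_chain[unfolded o_def])
  then have "((\<lambda>y. blowup_integral k x 1 - blowup_integral k x (1 / (y + 1))) has_real_derivative
      0 - 1 / ?d * (- 1 / (y + 1)\<^sup>2)) (at y within {0..})"
    by (intro DERIV_diff DERIV_const)
  \<comment> \<open>The product is (y + 1) (y + x) for k = 1 and (y + 1)^2 + x - 1 for k =
    2.\<close>
  moreover have "?d * (y + 1)\<^sup>2 = y\<^sup>2 + (1 + (if k = 1 then x else 1)) * y + x"
    using k y by (auto simp: z_def field_simps power2_eq_square)
  then have "0 - 1 / ?d * (- 1 / (y + 1)\<^sup>2) = 1 / (y\<^sup>2 + (1 + (if k = 1 then x else 1)) * y + x)"
    by (simp flip: mult_minus_right)
  ultimately show "((\<lambda>y. blowup_integral k x 1 - blowup_integral k x (1 / (y + 1))) has_real_derivative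
      1 / (y\<^sup>2 + (1 + (if k = 1 then x else 1)) * y + x)) (at y within {0..})"
    by simp
next
  fix y :: real assume y: "y \<ge> 0"
  show "blowup_integral k x 1 - blowup_integral k x (1 / (y + 1)) < blowup_integral k x 1"
    using blowup_integral_pos[of x "1 / (y + 1)" k] x y by simp
next
  have "((\<lambda>y::real. 1 / (y + 1)) \<longlongrightarrow> 0) at_top" by real_asymp
  then have "((\<lambda>y. blowup_integral k x (1 / (y + 1))) \<longlongrightarrow> blowup_integral k x 0) at_top"
    by (rule continuous_on_tendsto_compose[OF continuous_on_blowup_integral[OF x]])
       (auto intro!: eventually_mono[OF eventually_ge_at_top[of 0]])
  then show "((\<lambda>y. blowup_integral k x 1 - blowup_integral k x (1 / (y + 1))) \<longlongrightarrow> blowup_integral k x 1) at_top"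
    by (auto intro: tendsto_eq_intros)
qed (use x in auto)

lemma chain_poly_growth:
  assumes x: "x > 0" and k: "k \<in> {1, 2}"
  shows "(\<lambda>n. ln (poly (chain_poly k n) x) / real n) \<longlonglongrightarrow> - ln (blowup_integral k x 1)"
proof (rule riccati_blowup.growth_rate[OF riccati_blowup_chain_poly[OF assms]])
  \<comment> \<open>With \<open>e1 = 1\<close> and \<open>e2\<close> equal to \<open>x\<close> or 1,
    all four conditions on the constant reduce to \<open>c \<le> 1\<close> and
    \<open>c * x \<le> 1\<close>.\<close>
  show "min 1 (1 / x) > 0" using x by simp
qed (use x in \<open>auto simp: min_def field_simps\<close>)

text \<open>Differentiation under the integral sign. It yields the differentiability of the pressure
  on which the lower large deviation bound rests.\<close>

lemma blowup_integral_differentiable: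
  assumes x: "x > 0"
  shows "\<exists>D. ((\<lambda>x. blowup_integral k x 1) has_real_derivative D) (at x)"
proof -
  have pos: "1 + (y - 1) * u ^ k > 0" if "y \<in> {0<..}" "u \<in> cbox 0 1" for y u :: real
    using blowup_denominator_pos[of y u k] that by simp
  have "((\<lambda>y. integral (cbox 0 1) (\<lambda>u. 1 / (1 + (y - 1) * u ^ k))) has_real_derivative
      integral (cbox 0 1) (\<lambda>u. - (u ^ k) / (1 + (x - 1) * u ^ k)\<^sup>2)) (at x within {0<..})"
  proof (rule leibniz_rule_field_derivative)
    fix y u :: real assume yu: "y \<in> {0<..}" "u \<in> cbox 0 1"
    show "((\<lambda>y. 1 / (1 + (y - 1) * u ^ k)) has_real_derivative - (u ^ k) / (1 + (y - 1) * u ^ k)\<^sup>2) (at y within {0<..})"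
      using pos[OF yu] by (auto intro!: derivative_eq_intros simp: power2_eq_square)
  next
    fix y :: real assume "y \<in> {0<..}"
    then show "(\<lambda>u. 1 / (1 + (y - 1) * u ^ k)) integrable_on cbox 0 1"
      using continuous_on_blowup_integrand[of y k] by (intro integrable_continuous) simp
  next
    show "continuous_on ({0<..} \<times> cbox 0 1) (\<lambda>(y, u). - (u ^ k) / (1 + (y - 1) * u ^ k)\<^sup>2 :: real)"
      unfolding split_beta
    proof (intro continuous_intros ballI)
      fix p :: "real \<times> real" assume "p \<in> {0<..} \<times> cbox 0 1"
      then show "(1 + (fst p - 1) * snd p ^ k)\<^sup>2 \<noteq> 0" using pos[of "fst p" "snd p"] by auto
    qed
  qed (use x in auto)
  then show ?thesis
    using x at_within_open[of x "{0<..}"] by (auto simp: blowup_integral_def)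
qed

text \<open>The substitution \<open>u = ((e\<^sup>t - 1) / (e\<^sup>l - 1))\<^sup>\<alpha>\<close> turns one integrand into the other.\<close>
lemma interval_integral_eq_blowup_integral:
  fixes l \<alpha> :: real
  assumes l: "l \<noteq> 0" and k: "k \<ge> 1" and \<alpha>: "\<alpha> = 1 / real k"
  shows "\<alpha> / (exp l - 1) * (LBINT t=ereal 0..ereal l. ((exp t - 1) / (exp l - 1)) powr (\<alpha> - 1))
      = blowup_integral k (exp l) 1"
proof -
  define g where "g t = (exp t - 1) / (exp l - 1)" for t
  define F where "F t = (exp l - 1) / \<alpha> * blowup_integral k (exp l) (g t powr \<alpha>)" for t
  \<comment> \<open>Ordering the endpoints treats both signs of \<open>l\<close> at once;
    orientation is restored at the end.\<close>
  define a where "a = min 0 l"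
  define b where "b = max 0 l"
  have ab: "a < b" using l by (auto simp: a_def b_def)
  have \<alpha>pos: "\<alpha> > 0" using k \<alpha> by simp
  have el: "exp l - 1 \<noteq> 0" using l by simp
  have g_range: "0 \<le> g t \<and> g t \<le> 1" if "t \<in> {a..b}" for t
    using that l by (cases "l > 0") (auto simp: g_def a_def b_def field_simps)
  have g_strict: "0 < g t \<and> g t < 1" if "a < t" "t < b" for t
    using that l by (cases "l > 0") (auto simp: g_def a_def b_def field_simps)
  have z_range: "0 \<le> g t powr \<alpha> \<and> g t powr \<alpha> \<le> 1" if "t \<in> {a..b}" for t
    using g_range[OF that] powr_mono2[of \<alpha> "g t" 1] \<alpha>pos by simp
  have g_cont: "continuous_on {a..b} g" unfolding g_def using el by (intro continuous_intros) auto
  have "continuous_on {a..b} (\<lambda>t. g t powr \<alpha>)"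
    by (rule continuous_on_powr'[OF g_cont continuous_on_const]) (use g_range \<alpha>pos in auto)
  then have "continuous_on {a..b} (\<lambda>t. blowup_integral k (exp l) (g t powr \<alpha>))"
    by (rule continuous_on_compose2[OF continuous_on_blowup_integral[OF exp_gt_zero]]) (use z_range in auto)
  then have F_cont: "continuous_on {a..b} F" unfolding F_def by (rule continuous_on_mult_left)
  have F_deriv: "DERIV F t :> g t powr (\<alpha> - 1)" if t: "a < t" "t < b" for t
  proof -
    have gt: "0 < g t" "g t < 1" using g_strict[OF t] by auto
    define z where "z = g t powr \<alpha>"
    have z: "0 < z" "z < 1"
      using gt powr_less_mono2[of \<alpha> "g t" 1] \<alpha>pos by (auto simp: z_def)
    have "z ^ k = g t"
      using gt k \<alpha> by (simp add: z_def powr_powr flip: powr_realpow)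
    then have den: "1 + (exp l - 1) * z ^ k = exp t" using el by (simp add: g_def)
    have "DERIV (blowup_integral k (exp l)) z :> 1 / exp t"
      using blowup_integral_deriv[of "exp l" z k] z at_within_interior[of z "{0..1}"] den by simp
    moreover have "DERIV g t :> exp t / (exp l - 1)"
      unfolding g_def using el by (auto intro!: derivative_eq_intros)
    then have "DERIV (\<lambda>t. g t powr \<alpha>) t :> \<alpha> * g t powr (\<alpha> - of_nat 1) * (exp t / (exp l - 1))"
      by (rule DERIV_fun_powr) (use gt in simp)
    ultimately have "DERIV (\<lambda>t. blowup_integral k (exp l) (g t powr \<alpha>)) t :>
        1 / exp t * (\<alpha> * g t powr (\<alpha> - of_nat 1) * (exp t / (exp l - 1)))"
      unfolding z_def by (rule DERIV_chain2)
    then have "DERIV F t :> (exp l - 1) / \<alpha> * (1 / exp t * (\<alpha> * g t powr (\<alpha> - of_nat 1) * (exp t / (exp l - 1))))"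
      unfolding F_def by (rule DERIV_cmult)
    then show ?thesis using el \<alpha>pos by simp
  qed
  \<comment> \<open>For \<alpha> < 1 the integrand is unbounded near t = 0, so the fundamental
    theorem is used for a nonnegative integrand on the open interval with one-sided limits of
    \<open>F\<close>.\<close>
  have FTC: "(LBINT t=ereal a..ereal b. g t powr (\<alpha> - 1)) = F b - F a"
  proof (rule interval_integral_FTC_nonneg(2))
    fix t assume "ereal a < ereal t" "ereal t < ereal b"
    then have t: "a < t" "t < b" by auto
    show "DERIV F t :> g t powr (\<alpha> - 1)" by (rule F_deriv[OF t])
    have "isCont g t" unfolding g_def using el by (intro continuous_intros) auto
    then show "isCont (\<lambda>t. g t powr (\<alpha> - 1)) t"
      using g_strict[OF t] by (intro continuous_intros) auto
  next
    show "((F \<circ> real_of_ereal) \<longlongrightarrow> F a) (at_right (ereal a))"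
      using continuous_on_Icc_at_rightD[OF F_cont ab] by (simp add: ereal_tendsto_simps)
    show "((F \<circ> real_of_ereal) \<longlongrightarrow> F b) (at_left (ereal b))"
      using continuous_on_Icc_at_leftD[OF F_cont ab] by (simp add: ereal_tendsto_simps)
  qed (use ab in auto)
  have F_ends: "F 0 = 0" "F l = (exp l - 1) / \<alpha> * blowup_integral k (exp l) 1"
    using el by (simp_all add: F_def g_def)
  have "(LBINT t=ereal 0..ereal l. g t powr (\<alpha> - 1)) = F l"
  proof (cases "l > 0")
    case True
    then show ?thesis using FTC F_ends by (simp add: a_def b_def)
  next
    case False
    have "(LBINT t=ereal 0..ereal l. g t powr (\<alpha> - 1)) = - (LBINT t=ereal l..ereal 0. g t powr (\<alpha> - 1))"
      by (rule interval_integral_endpoints_reverse)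
    then show ?thesis using FTC F_ends False l by (simp add: a_def b_def)
  qed
  then show ?thesis using el \<alpha>pos by (simp add: F_ends g_def)
qed

subsection \<open>The Gaertner-Ellis theorem on the real line\<close>

lemma limsup_elog_le:
  assumes p: "\<And>n. p n \<ge> 0" and K: "K > 0"
    and ev: "eventually (\<lambda>n. p n \<le> K * exp (- (real n * c))) sequentially"
  shows "limsup (\<lambda>n. ereal (1 / real n) * elog (p n)) \<le> ereal (- c)"
proof -
  have "limsup (\<lambda>n. ereal (1 / real n) * elog (p n)) \<le> limsup (\<lambda>n. ereal (ln K / real n - c))"
  proof (rule Limsup_mono)
    show "eventually (\<lambda>n. ereal (1 / real n) * elog (p n) \<le> ereal (ln K / real n - c)) sequentially"
      using ev eventually_gt_at_top[of 0]
    proof eventually_elim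
      case (elim n)
      show ?case
      proof (cases "p n = 0")
        case True
        then show ?thesis using elim by (simp add: elog_def)
      next
        case False
        then have "ln (p n) \<le> ln (K * exp (- (real n * c)))" using p[of n] elim K by simp
        also have "\<dots> = ln K - real n * c" using K by (simp add: ln_mult)
        finally have "1 / real n * ln (p n) \<le> 1 / real n * (ln K - real n * c)"
          by (rule mult_left_mono) simp
        then show ?thesis using False elim by (simp add: elog_def diff_divide_distrib)
      qed
    qed
  qed
  also have "(\<lambda>n. ln K / real n - c) \<longlonglongrightarrow> - c"
    by (rule tendsto_eq_intros tendsto_divide_0[OF tendsto_const] filterlim_real_sequentially
        filterlim_at_top_imp_at_infinity refl | simp)+
  then have "limsup (\<lambda>n. ereal (ln K / real n - c)) = ereal (- c)"
    by (intro lim_imp_Limsup) auto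
  finally show ?thesis .
qed

lemma liminf_elog_ge:
  assumes ev: "\<And>d. d > 0 \<Longrightarrow> eventually (\<lambda>n. p n \<ge> exp (- (real n * (c + d)))) sequentially"
  shows "liminf (\<lambda>n. ereal (1 / real n) * elog (p n)) \<ge> ereal (- c)"
proof (rule ereal_le_epsilon2)
  fix d :: real assume d: "d > 0"
  have "eventually (\<lambda>n. ereal (- c - d) \<le> ereal (1 / real n) * elog (p n)) sequentially"
    using ev[OF d] eventually_gt_at_top[of 0]
  proof eventually_elim
    case (elim n)
    have p: "p n > 0" using elim(1) exp_gt_zero[of "- (real n * (c + d))"] by linarith
    then have "- (real n * (c + d)) \<le> ln (p n)" using elim by (simp add: ln_ge_iff)
    then have "1 / real n * (- (real n * (c + d))) \<le> 1 / real n * ln (p n)"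
      by (rule mult_left_mono) simp
    then show ?case using elim p by (simp add: elog_def)
  qed
  then have "ereal (- c - d) \<le> liminf (\<lambda>n. ereal (1 / real n) * elog (p n))"
    by (rule Liminf_bounded)
  then have "ereal (- c - d) + ereal d \<le> liminf (\<lambda>n. ereal (1 / real n) * elog (p n)) + ereal d"
    by (rule add_right_mono)
  then show "ereal (- c) \<le> liminf (\<lambda>n. ereal (1 / real n) * elog (p n)) + ereal d" by simp
qed

text \<open>The limit is finite and differentiable on the whole line, so steepness at a boundary of
  its domain is vacuous.\<close>

locale gaertner_ellis = prob_space M for M :: "'a measure" +
  fixes Z :: "nat \<Rightarrow> 'a \<Rightarrow> real" and L L' :: "real \<Rightarrow> real"
  assumes Z_measurable: "\<And>n. n \<ge> 1 \<Longrightarrow> Z n \<in> borel_measurable M"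
    and exp_integrable: "\<And>n l. n \<ge> 1 \<Longrightarrow> integrable M (\<lambda>\<omega>. exp (l * Z n \<omega>))"
    and rate_limit: "\<And>l. log_mgf_rate M Z l \<longlonglongrightarrow> L l"
    and L_deriv: "\<And>l. DERIV L l :> L' l"
begin

abbreviation "rate \<equiv> log_mgf_rate M Z"

definition mgf :: "nat \<Rightarrow> real \<Rightarrow> real" where
  "mgf n l = (\<integral>\<omega>. exp (l * Z n \<omega>) \<partial>M)"

text \<open>The exponentially tilted law of \<open>Z n / n\<close>, left unnormalised: its total
  mass is \<open>mgf n l\<close>, and \<open>l = 0\<close> gives back the original law.\<close>

definition tilted :: "nat \<Rightarrow> real \<Rightarrow> real set \<Rightarrow> real" where
  "tilted n l A = (\<integral>\<omega>. exp (l * Z n \<omega>) * indicator A (Z n \<omega> / real n) \<partial>M)"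

lemma mgf_pos:
  assumes "n \<ge> 1"
  shows "mgf n l > 0"
proof -
  have "mgf n l \<noteq> 0"
    using integral_nonneg_eq_0_iff_AE[OF exp_integrable[OF assms, of l]] by (simp add: mgf_def)
  moreover have "mgf n l \<ge> 0" unfolding mgf_def by (rule Bochner_Integration.integral_nonneg) simp
  ultimately show ?thesis by simp
qed

lemma mgf_eq: "n \<ge> 1 \<Longrightarrow> mgf n l = exp (real n * rate l n)"
  using mgf_pos[of n l] by (simp add: log_mgf_rate_def mgf_def)

lemma tilted_integrable:
  assumes "n \<ge> 1" "A \<in> sets borel"
  shows "integrable M (\<lambda>\<omega>. exp (l * Z n \<omega>) * indicator A (Z n \<omega> / real n))"
proof (rule Bochner_Integration.integrable_bound[OF exp_integrable[OF assms(1), of l]])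
  note [measurable] = Z_measurable[OF assms(1)] assms(2)
  show "(\<lambda>\<omega>. exp (l * Z n \<omega>) * indicator A (Z n \<omega> / real n)) \<in> borel_measurable M" by measurable
qed (auto simp: indicator_def)

lemma tilted_0:
  assumes "n \<ge> 1" "A \<in> sets borel"
  shows "tilted n 0 A = prob {\<omega> \<in> space M. Z n \<omega> / real n \<in> A}"
proof -
  note [measurable] = Z_measurable[OF assms(1)] assms(2)
  have "tilted n 0 A = (\<integral>\<omega>. indicator {\<omega> \<in> space M. Z n \<omega> / real n \<in> A} \<omega> \<partial>M)"
    unfolding tilted_def by (intro Bochner_Integration.integral_cong) (auto simp: indicator_def)
  also have "\<dots> = prob {\<omega> \<in> space M. Z n \<omega> / real n \<in> A}" by simp
  finally show ?thesis .
qed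

text \<open>On the event, exp (\<theta> (Z n - n w)) is at least 1. The sign of \<theta> selects the
  half-line; \<open>l = 0\<close> serves the upper bound and general \<open>l\<close> the
  concentration of the tilted law.\<close>

lemma tilted_chernoff:
  assumes "n \<ge> 1" "A \<in> sets borel" and A: "\<And>z. z \<in> A \<Longrightarrow> \<theta> * w \<le> \<theta> * z"
  shows "tilted n l A \<le> exp (- (real n * \<theta> * w)) * mgf n (l + \<theta>)"
proof -
  have "tilted n l A \<le> (\<integral>\<omega>. exp (- (real n * \<theta> * w)) * exp ((l + \<theta>) * Z n \<omega>) \<partial>M)"
    unfolding tilted_def
  proof (intro integral_mono tilted_integrable assms integrable_mult_right exp_integrable)
    fix \<omega>
    have "exp (l * Z n \<omega>) \<le> exp (- (real n * \<theta> * w)) * exp ((l + \<theta>) * Z n \<omega>)" if "Z n \<omega> / real n \<in> A"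
    proof -
      have "real n * (\<theta> * w) \<le> real n * (\<theta> * (Z n \<omega> / real n))"
        using A[OF that] by (rule mult_left_mono) simp
      then have "l * Z n \<omega> \<le> - (real n * \<theta> * w) + (l + \<theta>) * Z n \<omega>"
        using assms(1) by (simp add: algebra_simps)
      then show ?thesis by (simp flip: exp_add)
    qed
    then show "exp (l * Z n \<omega>) * indicator A (Z n \<omega> / real n)
        \<le> exp (- (real n * \<theta> * w)) * exp ((l + \<theta>) * Z n \<omega>)"
      by (auto simp: indicator_def)
  qed
  then show ?thesis by (simp add: mgf_def)
qed

section \<open>Convexity of the limit and its Legendre transform\<close>

lemma L_0: "L 0 = 0"
proof -
  have "rate 0 = (\<lambda>n. 0)" by (rule ext) (simp add: log_mgf_rate_def prob_space)
  then show ?thesis using LIMSEQ_unique[OF rate_limit[of 0]] by simp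
qed

text \<open>Hoelder's inequality, derived from convexity of exp after both exponentials have been
  normalised to mean 1.\<close>

lemma rate_convex:
  assumes n: "n \<ge> 1" and u: "0 \<le> u" "u \<le> 1"
  shows "rate ((1 - u) * a + u * b) n \<le> (1 - u) * rate a n + u * rate b n"
proof -
  let ?c = "(1 - u) * a + u * b" and ?r = "(1 - u) * rate a n + u * rate b n"
  have "mgf n ?c * exp (- (real n * ?r)) = (\<integral>\<omega>. exp (?c * Z n \<omega>) * exp (- (real n * ?r)) \<partial>M)"
    by (simp add: mgf_def)
  also have "\<dots> \<le> (\<integral>\<omega>. (1 - u) * (exp (a * Z n \<omega>) * exp (- (real n * rate a n)))
      + u * (exp (b * Z n \<omega>) * exp (- (real n * rate b n))) \<partial>M)"
  proof (rule integral_mono)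
    fix \<omega>
    have "exp ((1 - u) * (a * Z n \<omega> - real n * rate a n) + u * (b * Z n \<omega> - real n * rate b n))
        \<le> (1 - u) * exp (a * Z n \<omega> - real n * rate a n) + u * exp (b * Z n \<omega> - real n * rate b n)"
      using convex_onD[OF exp_convex, of u "a * Z n \<omega> - real n * rate a n" "b * Z n \<omega> - real n * rate b n"] u
      by simp
    then show "exp (?c * Z n \<omega>) * exp (- (real n * ?r)) \<le>
        (1 - u) * (exp (a * Z n \<omega>) * exp (- (real n * rate a n)))
        + u * (exp (b * Z n \<omega>) * exp (- (real n * rate b n)))"
      by (simp add: algebra_simps exp_add[symmetric] exp_diff[symmetric] flip: exp_minus)
  qed (use exp_integrable[OF n] in auto)
  also have "\<dots> = (1 - u) * (mgf n a * exp (- (real n * rate a n)))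
      + u * (mgf n b * exp (- (real n * rate b n)))"
    using exp_integrable[OF n] by (simp add: mgf_def)
  also have "\<dots> = 1" using n by (simp add: mgf_eq flip: exp_add)
  finally have "exp (real n * rate ?c n - real n * ?r) \<le> 1"
    using n by (simp add: mgf_eq flip: exp_add)
  then have "real n * rate ?c n \<le> real n * ?r" by simp
  then show ?thesis using n by (simp only: mult_le_cancel_left_pos of_nat_0_less_iff)
qed

lemma L_convex: "convex_on UNIV L"
proof (rule convex_onI)
  fix u a b :: real assume u: "0 < u" "u < 1"
  show "L ((1 - u) *\<^sub>R a + u *\<^sub>R b) \<le> (1 - u) * L a + u * L b"
  proof (rule LIMSEQ_le[OF rate_limit])
    show "(\<lambda>n. (1 - u) * rate a n + u * rate b n) \<longlonglongrightarrow> (1 - u) * L a + u * L b"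
      by (intro tendsto_intros rate_limit)
    show "\<exists>N. \<forall>n\<ge>N. rate ((1 - u) *\<^sub>R a + u *\<^sub>R b) n \<le> (1 - u) * rate a n + u * rate b n"
      using rate_convex[of _ u a b] u by (intro exI[of _ 1]) auto
  qed
qed simp

lemma L_tangent: "l * L' 0 \<le> L l"
proof -
  have "L l - L 0 \<ge> L' 0 * (l - 0)"
    by (rule convex_on_imp_above_tangent[OF L_convex]) (use L_deriv[of 0] in auto)
  then show ?thesis unfolding L_0 by (simp only: diff_0_right mult.commute)
qed

lemma legendre_ge: "ereal (l * x - L l) \<le> legendre_transform L x"
  unfolding legendre_transform_def by (rule SUP_upper) simp

lemma legendre_nonneg: "0 \<le> legendre_transform L x"
  using legendre_ge[of 0 x] L_0 by (simp add: zero_ereal_def)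

lemma legendre_mean: "legendre_transform L (L' 0) \<le> 0"
  unfolding legendre_transform_def by (rule SUP_least) (use L_tangent in auto)

lemma compact_level_set: "compact {x. legendre_transform L x \<le> ereal a}"
proof -
  have eq: "{x. legendre_transform L x \<le> ereal a} = (\<Inter>l. {x. l * x - L l \<le> a})"
    unfolding legendre_transform_def by (auto simp: SUP_le_iff)
  have "closed {x. legendre_transform L x \<le> ereal a}"
    unfolding eq by (intro closed_INT ballI closed_Collect_le continuous_intros)
  \<comment> \<open>The slopes 1 and -1 alone already confine the level set.\<close>
  moreover have "{x. legendre_transform L x \<le> ereal a} \<subseteq> {- (a + L (- 1)) .. a + L 1}"
  proof
    fix x assume "x \<in> {x. legendre_transform L x \<le> ereal a}"
    then have "1 * x - L 1 \<le> a" "- 1 * x - L (- 1) \<le> a" unfolding eq by blast+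
    then show "x \<in> {- (a + L (- 1)) .. a + L 1}" by simp
  qed
  then have "bounded {x. legendre_transform L x \<le> ereal a}" by (rule bounded_subset[OF bounded_closed_interval])
  ultimately show ?thesis by (simp add: compact_eq_bounded_closed)
qed

subsubsection \<open>Upper bound\<close>

lemma chernoff_eventually:
  assumes "A \<in> sets borel" and A: "\<And>z. z \<in> A \<Longrightarrow> \<theta> * w \<le> \<theta> * z" and c: "\<theta> * w - L \<theta> > c"
  shows "eventually (\<lambda>n. prob {\<omega> \<in> space M. Z n \<omega> / real n \<in> A} \<le> exp (- (real n * c))) sequentially"
proof -
  have "eventually (\<lambda>n. rate \<theta> n < \<theta> * w - c) sequentially"
    using c by (intro order_tendstoD(2)[OF rate_limit]) simp
  then show ?thesis using eventually_ge_at_top[of 1]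
  proof eventually_elim
    case (elim n)
    have "prob {\<omega> \<in> space M. Z n \<omega> / real n \<in> A} \<le> exp (- (real n * \<theta> * w)) * mgf n (0 + \<theta>)"
      using tilted_chernoff[OF elim(2) assms(1) A, of 0] tilted_0[OF elim(2) assms(1)] by simp
    also have "\<dots> = exp (real n * (rate \<theta> n - \<theta> * w))"
      using elim by (simp add: mgf_eq algebra_simps flip: exp_add)
    also have "\<dots> \<le> exp (real n * (- c))"
      unfolding exp_le_cancel_iff by (rule mult_left_mono) (use elim in auto)
    finally show ?case by simp
  qed
qed

text \<open>The sign \<open>s\<close> selects the side of the mean \<open>L' 0\<close>. On that side
  the point of the closure nearest to the mean governs the whole set, and a Chernoff bound is
  applied there.\<close>

lemma half_line_bound:
  assumes U: "U \<in> sets borel" and c: "\<And>x. x \<in> closure U \<Longrightarrow> ereal c < legendre_transform L x"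
    and s: "s = 1 \<or> s = (- 1 :: real)"
  shows "eventually (\<lambda>n. prob {\<omega> \<in> space M. Z n \<omega> / real n \<in> {z \<in> U. s * z \<ge> s * L' 0}}
      \<le> exp (- (real n * c))) sequentially"
proof (cases "{z \<in> U. s * z \<ge> s * L' 0} = {}")
  case True
  then show ?thesis by (simp only: True empty_iff) simp
next
  case False
  have s2: "s * s = 1" using s by auto
  define C where "C = (\<lambda>z. s * z) ` {z \<in> closure U. s * z \<ge> s * L' 0}"
  have C_eq: "C = {v. s * v \<in> closure U \<and> v \<ge> s * L' 0}"
    unfolding C_def using s by (auto simp: image_iff) (force simp: minus_equation_iff)+
  have "closed C"
    unfolding C_eq Collect_conj_eq
    by (intro closed_Int closed_Collect_le continuous_intros
          continuous_closed_vimage[of "closure U" "\<lambda>v. s * v", unfolded vimage_def]) auto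
  moreover have "C \<noteq> {}" using False closure_subset unfolding C_def by blast
  moreover have bdd: "bdd_below C" unfolding C_def by (intro bdd_belowI) auto
  ultimately have "Inf C \<in> C" by (intro closed_contains_Inf)
  then obtain w where w: "w \<in> closure U" "s * w \<ge> s * L' 0" "s * w = Inf C" unfolding C_def by auto
  have w_le: "s * w \<le> s * z" if "z \<in> U" "s * z \<ge> s * L' 0" for z
    unfolding w(3) by (rule cInf_lower[OF _ bdd]) (use that closure_subset in \<open>auto simp: C_def\<close>)
  have "ereal c < legendre_transform L w" using c w by blast
  then obtain l where l: "l * w - L l > c" unfolding legendre_transform_def by (auto simp: less_SUP_iff)
  \<comment> \<open>A slope of the wrong sign gives at most 0 by the tangent inequality at the mean.
    Then \<open>c < 0\<close>, and slope 0 does as well.\<close>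
  have "\<exists>\<theta>. s * \<theta> \<ge> 0 \<and> \<theta> * w - L \<theta> > c"
  proof (cases "s * l \<ge> 0")
    case False
    have "(s * l) * (s * (w - L' 0)) \<le> 0"
      by (rule mult_nonpos_nonneg) (use False w(2) in \<open>simp_all only: right_diff_distrib not_le less_imp_le diff_ge_0_iff_ge\<close>)
    also have "(s * l) * (s * (w - L' 0)) = (s * s) * (l * w - l * L' 0)" by (simp add: algebra_simps)
    finally have "l * w - L l \<le> 0" using L_tangent[of l] s2 by simp
    then show ?thesis using l L_0 by (intro exI[of _ 0]) auto
  qed (use l in auto)
  then obtain \<theta> where \<theta>: "s * \<theta> \<ge> 0" "\<theta> * w - L \<theta> > c" by blast
  show ?thesis
  proof (rule chernoff_eventually[OF _ _ \<theta>(2)])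
    fix z assume z: "z \<in> {z \<in> U. s * z \<ge> s * L' 0}"
    then have "(s * \<theta>) * (s * w) \<le> (s * \<theta>) * (s * z)"
      using w_le by (intro mult_left_mono[OF _ \<theta>(1)]) auto
    also have "(s * \<theta>) * (s * w) = (s * s) * (\<theta> * w)" by (simp add: algebra_simps)
    also have "(s * \<theta>) * (s * z) = (s * s) * (\<theta> * z)" by (simp add: algebra_simps)
    finally show "\<theta> * w \<le> \<theta> * z" using s2 by simp
  next
    note [measurable] = U
    have "{z \<in> U. s * z \<ge> s * L' 0} = U \<inter> {z. s * z \<ge> s * L' 0}" by auto
    also have "\<dots> \<in> sets borel" by measurable
    finally show "{z \<in> U. s * z \<ge> s * L' 0} \<in> sets borel" .
  qed
qed

text \<open>The set is cut at the mean into two pieces with the same exponential bound; the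
  resulting factor 2 disappears on the logarithmic scale.\<close>

lemma upper_bound:
  assumes U: "U \<in> sets borel"
  shows "limsup (\<lambda>n. ereal (1 / real n) * elog (\<P>(\<omega> in M. Z n \<omega> / real n \<in> U)))
      \<le> - (INF x\<in>closure U. legendre_transform L x)"
proof (rule ccontr)
  let ?p = "\<lambda>n. \<P>(\<omega> in M. Z n \<omega> / real n \<in> U)"
  assume "\<not> ?thesis"
  then have "- limsup (\<lambda>n. ereal (1 / real n) * elog (?p n)) < (INF x\<in>closure U. legendre_transform L x)"
    by (simp add: not_le ereal_uminus_less_reorder)
  then obtain c where c: "- limsup (\<lambda>n. ereal (1 / real n) * elog (?p n)) < ereal c"
      "ereal c < (INF x\<in>closure U. legendre_transform L x)"
    using ereal_dense2 by blast
  have c': "ereal c < legendre_transform L x" if "x \<in> closure U" for x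
    using c(2) INF_lower[OF that, of "legendre_transform L"] by (rule less_le_trans)
  note half = half_line_bound[OF U c']
  have "eventually (\<lambda>n. ?p n \<le> 2 * exp (- (real n * c))) sequentially"
    using half[where s = 1, simplified] half[where s = "- 1", simplified] eventually_ge_at_top[of 1]
  proof eventually_elim
    case (elim n)
    note [measurable] = Z_measurable[OF elim(3)] U
    let ?A = "{\<omega> \<in> space M. Z n \<omega> / real n \<in> U \<and> L' 0 \<le> Z n \<omega> / real n}"
      and ?B = "{\<omega> \<in> space M. Z n \<omega> / real n \<in> U \<and> Z n \<omega> / real n \<le> L' 0}"
    have "?p n \<le> prob (?A \<union> ?B)" by (intro finite_measure_mono) auto
    also have "\<dots> \<le> prob ?A + prob ?B" by (intro measure_Un_le) auto
    finally show ?case using elim(1,2) by simp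
  qed
  then have "limsup (\<lambda>n. ereal (1 / real n) * elog (?p n)) \<le> ereal (- c)"
    by (intro limsup_elog_le) auto
  moreover have "ereal (- c) < limsup (\<lambda>n. ereal (1 / real n) * elog (?p n))"
    using c(1) by (simp add: ereal_uminus_less_reorder)
  ultimately show False by simp
qed

subsubsection \<open>Lower bound\<close>

text \<open>By the Chernoff bound the tilted mass is an exponentially small fraction of the total. A
  quarter is enough: two such tails leave half of the mass in the middle.\<close>

lemma tilted_quarter:
  assumes "A \<in> sets borel" and A: "\<And>z. z \<in> A \<Longrightarrow> \<theta> * w \<le> \<theta> * z" and w: "L (l + \<theta>) - L l < \<theta> * w"
  shows "eventually (\<lambda>n. tilted n l A \<le> mgf n l / 4) sequentially"
proof -
  define \<kappa> where "\<kappa> = (\<theta> * w - (L (l + \<theta>) - L l)) / 2"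
  have \<kappa>: "\<kappa> > 0" using w by (simp add: \<kappa>_def)
  have "(\<lambda>n. rate (l + \<theta>) n - rate l n) \<longlonglongrightarrow> L (l + \<theta>) - L l"
    by (intro tendsto_intros rate_limit)
  then have "eventually (\<lambda>n. rate (l + \<theta>) n - rate l n < \<theta> * w - \<kappa>) sequentially"
    by (rule order_tendstoD) (use \<kappa> in \<open>simp add: \<kappa>_def field_simps\<close>)
  moreover have "(\<lambda>n. exp (- (real n * \<kappa>))) \<longlonglongrightarrow> 0" using \<kappa> by real_asymp
  then have "eventually (\<lambda>n. exp (- (real n * \<kappa>)) < 1 / 4) sequentially" by (rule order_tendstoD) simp
  ultimately show ?thesis using eventually_ge_at_top[of 1]
  proof eventually_elim
    case (elim n)
    have "tilted n l A \<le> exp (- (real n * \<theta> * w)) * mgf n (l + \<theta>)"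
      by (rule tilted_chernoff[OF elim(3) assms(1) A])
    also have "\<dots> = mgf n l * exp (real n * (rate (l + \<theta>) n - rate l n - \<theta> * w))"
      using elim by (simp add: mgf_eq algebra_simps flip: exp_add)
    also have "\<dots> \<le> mgf n l * exp (real n * (- \<kappa>))"
    proof (intro mult_left_mono)
      show "exp (real n * (rate (l + \<theta>) n - rate l n - \<theta> * w)) \<le> exp (real n * (- \<kappa>))"
        unfolding exp_le_cancel_iff by (rule mult_left_mono) (use elim in auto)
    qed (use mgf_pos[OF elim(3), of l] in simp)
    also have "\<dots> \<le> mgf n l * (1 / 4)"
      using elim mgf_pos[OF elim(3), of l] by (intro mult_left_mono) auto
    finally show ?case by simp
  qed
qed

text \<open>To first order L(l + \<theta>) - L(l) is \<theta> L'(l), so a small \<theta> of the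
  right sign meets the tail condition at L'(l) + \<delta> or at L'(l) - \<delta>. Differentiability
  of \<open>L\<close> is used here.\<close>

lemma tilted_law_concentrates:
  assumes \<delta>: "\<delta> > 0"
  shows "eventually (\<lambda>n. tilted n l {L' l - \<delta> <..< L' l + \<delta>} \<ge> mgf n l / 2) sequentially"
proof -
  let ?y = "L' l"
  have shift: "DERIV (\<lambda>\<theta>. L (l + \<theta>)) 0 :> ?y"
    using L_deriv[of l] DERIV_shift[of L ?y 0 l] by (simp add: add.commute)
  have "DERIV (\<lambda>\<theta>. L (l + \<theta>) - \<theta> * (?y + \<delta>)) 0 :> ?y - 1 * (?y + \<delta>)"
    by (intro DERIV_diff shift DERIV_cmult_right DERIV_ident)
  from DERIV_neg_dec_right[OF this] \<delta> obtain d1 where d1: "d1 > 0"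
    "\<And>h. h > 0 \<Longrightarrow> h < d1 \<Longrightarrow> L (l + h) - h * (?y + \<delta>) < L l" by auto
  have "DERIV (\<lambda>\<theta>. L (l + \<theta>) - \<theta> * (?y - \<delta>)) 0 :> ?y - 1 * (?y - \<delta>)"
    by (intro DERIV_diff shift DERIV_cmult_right DERIV_ident)
  from DERIV_pos_inc_left[OF this] \<delta> obtain d2 where d2: "d2 > 0"
    "\<And>h. h > 0 \<Longrightarrow> h < d2 \<Longrightarrow> L (l - h) + h * (?y - \<delta>) < L l" by auto
  have "eventually (\<lambda>n. tilted n l {?y + \<delta>..} \<le> mgf n l / 4) sequentially"
    by (rule tilted_quarter[where \<theta> = "d1 / 2" and w = "?y + \<delta>"])
       (use d1(1) d1(2)[of "d1 / 2"] in \<open>auto intro!: mult_left_mono\<close>)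
  moreover have "eventually (\<lambda>n. tilted n l {..?y - \<delta>} \<le> mgf n l / 4) sequentially"
    by (rule tilted_quarter[where \<theta> = "- (d2 / 2)" and w = "?y - \<delta>"])
       (use d2(1) d2(2)[of "d2 / 2"] in \<open>auto intro!: mult_left_mono\<close>)
  ultimately show ?thesis using eventually_ge_at_top[of 1]
  proof eventually_elim
    case (elim n)
    note int = tilted_integrable[OF elim(3), of _ l]
    have "mgf n l \<le> (\<integral>\<omega>. exp (l * Z n \<omega>) * indicator {?y - \<delta> <..< ?y + \<delta>} (Z n \<omega> / real n)
        + (exp (l * Z n \<omega>) * indicator {?y + \<delta>..} (Z n \<omega> / real n)
        + exp (l * Z n \<omega>) * indicator {..?y - \<delta>} (Z n \<omega> / real n)) \<partial>M)"
      unfolding mgf_def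
    proof (intro integral_mono exp_integrable elim(3) Bochner_Integration.integrable_add int)
      fix \<omega>
      show "exp (l * Z n \<omega>) \<le> exp (l * Z n \<omega>) * indicator {?y - \<delta> <..< ?y + \<delta>} (Z n \<omega> / real n)
        + (exp (l * Z n \<omega>) * indicator {?y + \<delta>..} (Z n \<omega> / real n)
        + exp (l * Z n \<omega>) * indicator {..?y - \<delta>} (Z n \<omega> / real n))"
        by (cases "Z n \<omega> / real n \<ge> ?y + \<delta>"; cases "Z n \<omega> / real n \<le> ?y - \<delta>") (auto simp: indicator_def)
    qed auto
    also have "\<dots> = tilted n l {?y - \<delta> <..< ?y + \<delta>} + (tilted n l {?y + \<delta>..} + tilted n l {..?y - \<delta>})"
      unfolding tilted_def by (simp add: int)
    finally show ?case using elim by linarith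
  qed
qed

text \<open>A change of measure: the tilted law puts at least half of its mass near
  \<open>L' l\<close>, where the density exp (l Z n) is nearly constant on the exponential
  scale.\<close>

lemma lower_bound_exposed:
  assumes U: "U \<in> sets borel" and y: "L' l \<in> interior U"
  shows "ereal (- (l * L' l - L l)) \<le> liminf (\<lambda>n. ereal (1 / real n) * elog (\<P>(\<omega> in M. Z n \<omega> / real n \<in> U)))"
proof (rule liminf_elog_ge)
  fix d :: real assume d: "d > 0"
  let ?y = "L' l"
  obtain e where e: "e > 0" "ball ?y e \<subseteq> U" using y mem_interior by blast
  \<comment> \<open>The error \<open>d\<close> is shared equally by the width of the window, the
    convergence of \<open>rate l n\<close>, and the factor 1/2.\<close>
  define \<delta> where "\<delta> = min e (d / (3 * (\<bar>l\<bar> + 1)))"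
  have \<delta>: "\<delta> > 0" "\<delta> \<le> e" using e d by (auto simp: \<delta>_def)
  have l\<delta>: "\<bar>l\<bar> * \<delta> \<le> d / 3"
  proof -
    have "\<bar>l\<bar> * \<delta> \<le> (\<bar>l\<bar> + 1) * (d / (3 * (\<bar>l\<bar> + 1)))"
      using d \<delta> by (intro mult_mono) (auto simp: \<delta>_def)
    also have "\<dots> = d / 3" by (simp add: field_simps add_nonneg_eq_0_iff)
    finally show ?thesis .
  qed
  have "eventually (\<lambda>n. rate l n > L l - d / 3) sequentially"
    by (rule order_tendstoD(1)[OF rate_limit]) (use d in simp)
  moreover have "(\<lambda>n. exp (- (real n * (d / 3)))) \<longlonglongrightarrow> 0" using d by real_asymp
  then have "eventually (\<lambda>n. exp (- (real n * (d / 3))) < 1 / 2) sequentially" by (rule order_tendstoD) simp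
  ultimately show "eventually (\<lambda>n. exp (- (real n * (l * ?y - L l + d))) \<le> \<P>(\<omega> in M. Z n \<omega> / real n \<in> U)) sequentially"
    using tilted_law_concentrates[OF \<delta>(1), of l] eventually_ge_at_top[of 1]
  proof eventually_elim
    case (elim n)
    note [measurable] = Z_measurable[OF elim(4)] U
    let ?I = "{?y - \<delta> <..< ?y + \<delta>}"
    let ?E = "exp (real n * (l * ?y + d / 3))"
    have "tilted n l ?I \<le> (\<integral>\<omega>. ?E * (exp (0 * Z n \<omega>) * indicator ?I (Z n \<omega> / real n)) \<partial>M)"
      unfolding tilted_def
    proof (intro integral_mono integrable_mult_right tilted_integrable elim(4))
      fix \<omega>
      have "l * Z n \<omega> \<le> real n * (l * ?y + d / 3)" if z: "Z n \<omega> / real n \<in> ?I"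
      proof -
        have "l * (Z n \<omega> / real n - ?y) \<le> \<bar>l\<bar> * \<bar>Z n \<omega> / real n - ?y\<bar>"
          by (metis abs_ge_self abs_mult)
        also have "\<dots> \<le> \<bar>l\<bar> * \<delta>" using z by (intro mult_left_mono) (auto simp: abs_le_iff)
        finally have "l * (Z n \<omega> / real n) \<le> l * ?y + d / 3"
          using l\<delta> by (simp add: right_diff_distrib)
        then have "real n * (l * (Z n \<omega> / real n)) \<le> real n * (l * ?y + d / 3)"
          by (rule mult_left_mono) simp
        then show ?thesis using elim(4) by simp
      qed
      then show "exp (l * Z n \<omega>) * indicator ?I (Z n \<omega> / real n)
          \<le> ?E * (exp (0 * Z n \<omega>) * indicator ?I (Z n \<omega> / real n))"
        by (auto simp: indicator_def)
    qed auto
    also have "\<dots> = ?E * tilted n 0 ?I" by (simp add: tilted_def)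
    also have "tilted n 0 ?I \<le> \<P>(\<omega> in M. Z n \<omega> / real n \<in> U)"
    proof -
      have "?I \<subseteq> U" using e \<delta> by (auto simp: subset_eq dist_real_def abs_less_iff)
      then have "prob {\<omega> \<in> space M. Z n \<omega> / real n \<in> ?I} \<le> \<P>(\<omega> in M. Z n \<omega> / real n \<in> U)"
        by (intro finite_measure_mono) auto
      then show ?thesis using tilted_0[OF elim(4), of ?I] by simp
    qed
    finally have "exp (real n * rate l n) / 2 \<le> ?E * \<P>(\<omega> in M. Z n \<omega> / real n \<in> U)"
      using elim(3,4) by (simp add: mgf_eq)
    moreover have "exp (real n * (L l - d / 3)) * exp (- (real n * (d / 3))) \<le> exp (real n * rate l n) * (1 / 2)"
      using elim by (intro mult_mono) auto
    ultimately have "exp (real n * (L l - d / 3)) * exp (- (real n * (d / 3))) \<le> ?E * \<P>(\<omega> in M. Z n \<omega> / real n \<in> U)"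
      by linarith
    then have "exp (- (real n * (l * ?y + d / 3))) * (exp (real n * (L l - d / 3)) * exp (- (real n * (d / 3))))
        \<le> exp (- (real n * (l * ?y + d / 3))) * (?E * \<P>(\<omega> in M. Z n \<omega> / real n \<in> U))"
      by (rule mult_left_mono) simp
    also have "\<dots> = \<P>(\<omega> in M. Z n \<omega> / real n \<in> U)" by (simp flip: exp_add mult.assoc)
    also have "exp (- (real n * (l * ?y + d / 3))) * (exp (real n * (L l - d / 3)) * exp (- (real n * (d / 3))))
        = exp (- (real n * (l * ?y - L l + d)))"
      by (simp add: algebra_simps flip: exp_add)
    finally show ?case .
  qed
qed

text \<open>The function l y - L(l) is nonnegative at 0 and negative at both ends of a long
  interval, so it has an interior maximum, where its derivative y - L'(l) vanishes.\<close>

lemma derivative_attained: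
  assumes p: "p < y" "\<And>l. l * p - L l \<le> C" and q: "y < q" "\<And>l. l * q - L l \<le> C"
  shows "\<exists>l. L' l = y"
proof -
  define h where "h l = l * y - L l" for l
  have h_deriv: "DERIV h l :> y - L' l" for l
    unfolding h_def by (auto intro!: derivative_eq_intros L_deriv)
  have C: "C \<ge> 0" using p(2)[of 0] L_0 by simp
  define m where "m = min (y - p) (q - y)"
  \<comment> \<open>With \<open>K * m = C + 1\<close> the bounds at \<open>p\<close> and
    \<open>q\<close> give \<open>h (- K) \<le> -1\<close> and \<open>h K \<le> -1\<close>.\<close>
  define K where "K = (C + 1) / m"
  have m: "m > 0" using p q by (simp add: m_def)
  have K: "K > 0" "K * m = C + 1" using m C by (auto simp: K_def)
  have "K * m \<le> K * (q - y)" "K * m \<le> K * (y - p)"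
    using K(1) by (intro mult_left_mono; simp add: m_def)+
  then have ends: "h K < 0" "h (- K) < 0"
    using q(2)[of K] p(2)[of "- K"] K by (auto simp: h_def algebra_simps)
  have "continuous_on {-K..K} h"
    by (rule DERIV_continuous_on) (rule has_field_derivative_at_within[OF h_deriv])
  then obtain l where l: "l \<in> {-K..K}" "\<And>u. u \<in> {-K..K} \<Longrightarrow> h u \<le> h l"
    using continuous_attains_sup[of "{-K..K}" h] K by auto
  have "h l \<ge> 0" using l(2)[of 0] K L_0 by (simp add: h_def)
  then have int: "- K < l" "l < K" using l(1) ends by (force simp: less_le)+
  have "y - L' l = 0"
  proof (rule DERIV_local_max[OF h_deriv])
    show "min (l + K) (K - l) > 0" using int by simp
    show "\<forall>u. \<bar>l - u\<bar> < min (l + K) (K - l) \<longrightarrow> h u \<le> h l" by (auto intro!: l(2))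
  qed
  then show ?thesis by auto
qed

text \<open>Moving a little towards the mean \<open>L' 0\<close>, where the rate vanishes, makes a point exposed without
  increasing its rate.\<close>
lemma exposed_nearby:
  assumes G: "open G" "x \<in> G" and x: "legendre_transform L x = ereal C"
  shows "\<exists>l. L' l \<in> G \<and> l * L' l - L l \<le> C"
proof (cases "x = L' 0")
  case True
  have "0 \<le> C" using legendre_nonneg[of x] x by simp
  then show ?thesis using G True L_0 by (intro exI[of _ 0]) auto
next
  case False
  let ?m = "L' 0"
  have C: "C \<ge> 0" using legendre_nonneg[of x] x by simp
  have x_le: "l * x - L l \<le> C" for l using legendre_ge[of l x] x by simp
  have m_le: "l * ?m - L l \<le> 0" for l using L_tangent[of l] by simp
  have m_le': "l * ?m - L l \<le> C" for l using m_le[of l] C by linarith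
  obtain e where e: "e > 0" "ball x e \<subseteq> G" using G openE by blast
  \<comment> \<open>The second bound keeps \<open>y\<close> within \<open>e / 2\<close> of
    \<open>x\<close>; the first keeps it strictly between \<open>x\<close> and the mean.\<close>
  define t where "t = min (1 / 2) (e / (2 * \<bar>x - ?m\<bar>))"
  define y where "y = (1 - t) * x + t * ?m"
  have t: "0 < t" "t < 1" using e False by (auto simp: t_def)
  have "x - y = t * (x - ?m)" by (simp add: y_def algebra_simps)
  then have "dist x y = t * \<bar>x - ?m\<bar>" using t by (simp add: dist_real_def abs_mult)
  also have "\<dots> \<le> e / (2 * \<bar>x - ?m\<bar>) * \<bar>x - ?m\<bar>" by (intro mult_right_mono) (auto simp: t_def)
  also have "\<dots> < e" using e False by simp
  finally have yG: "y \<in> G" using e by auto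
  have "\<exists>l. L' l = y"
  proof (cases "x < ?m")
    case True
    have "x < y" "y < ?m"
      using t True mult_strict_left_mono[OF True t(1)] mult_strict_left_mono[OF True, of "1 - t"]
      by (auto simp: y_def algebra_simps)
    then show ?thesis using derivative_attained[of x y C ?m] x_le m_le' by blast
  next
    case False
    then have gt: "?m < x" using \<open>x \<noteq> ?m\<close> by simp
    have "?m < y" "y < x"
      using t mult_strict_left_mono[OF gt t(1)] mult_strict_left_mono[OF gt, of "1 - t"]
      by (auto simp: y_def algebra_simps)
    then show ?thesis using derivative_attained[of ?m y C x] x_le m_le' by blast
  qed
  then obtain l where l: "L' l = y" by blast
  have "l * y - L l = (1 - t) * (l * x - L l) + t * (l * ?m - L l)"
    by (simp add: y_def algebra_simps)
  also have "\<dots> \<le> (1 - t) * C + t * C"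
    using t x_le m_le' by (intro add_mono mult_left_mono) auto
  also have "\<dots> = C" by (simp add: algebra_simps)
  finally show ?thesis using l yG by auto
qed

lemma lower_bound:
  assumes U: "U \<in> sets borel"
  shows "- (INF x\<in>interior U. legendre_transform L x)
      \<le> liminf (\<lambda>n. ereal (1 / real n) * elog (\<P>(\<omega> in M. Z n \<omega> / real n \<in> U)))"
proof -
  let ?l = "liminf (\<lambda>n. ereal (1 / real n) * elog (\<P>(\<omega> in M. Z n \<omega> / real n \<in> U)))"
  have "- ?l \<le> (INF x\<in>interior U. legendre_transform L x)"
  proof (rule INF_greatest)
    fix x assume x: "x \<in> interior U"
    show "- ?l \<le> legendre_transform L x"
    proof (cases "legendre_transform L x")
      case (real C)
      then obtain l where l: "L' l \<in> interior U" "l * L' l - L l \<le> C"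
        using exposed_nearby[OF open_interior x] by blast
      have "ereal (- C) \<le> ereal (- (l * L' l - L l))" using l by simp
      also have "\<dots> \<le> ?l" by (rule lower_bound_exposed[OF U l(1)])
      finally show ?thesis using real by (simp add: ereal_uminus_le_reorder)
    next
      case MInf
      then show ?thesis using legendre_nonneg[of x] by simp
    qed simp
  qed
  then show ?thesis by (simp add: ereal_uminus_le_reorder)
qed

theorem large_deviations:
  "large_deviation_principle M (\<lambda>n \<omega>. Z n \<omega> / real n) (legendre_transform L)"
  unfolding large_deviation_principle_def
  using Z_measurable legendre_nonneg compact_level_set lower_bound upper_bound
  by (auto intro!: borel_measurable_divide)

end

subsection \<open>The law of the chain\<close>

text \<open>Here k = 1 / \<alpha>. Transition probabilities are stated as joint probabilities, so
  they also make sense at states of probability zero.\<close>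

locale lazy_increment_chain = prob_space M for M :: "'a measure" +
  fixes Z :: "nat \<Rightarrow> 'a \<Rightarrow> nat" and k k0 :: nat
  assumes k: "k \<in> {1, 2}" and k0: "k * k0 \<le> 1"
    and Z_measurable: "\<And>n. n \<ge> 1 \<Longrightarrow> Z n \<in> M \<rightarrow>\<^sub>M count_space UNIV"
    and Z_init: "AE \<omega> in M. Z 1 \<omega> = k0"
    and Z_up: "\<And>n j. n \<ge> 1 \<Longrightarrow> prob {\<omega> \<in> space M. Z (Suc n) \<omega> = Suc j \<and> Z n \<omega> = j}
        = prob {\<omega> \<in> space M. Z n \<omega> = j} * (1 - real k * real j / real n)"
    and Z_stay: "\<And>n j. n \<ge> 1 \<Longrightarrow> prob {\<omega> \<in> space M. Z (Suc n) \<omega> = j \<and> Z n \<omega> = j}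
        = prob {\<omega> \<in> space M. Z n \<omega> = j} * (real k * real j / real n)"
begin

abbreviation law :: "nat \<Rightarrow> nat \<Rightarrow> real" where
  "law n j \<equiv> prob {\<omega> \<in> space M. Z n \<omega> = j}"

text \<open>The masses of staying and moving up add to the mass at \<open>j\<close>, so any other
  transition from \<open>j\<close> is null; there are countably many \<open>j\<close>.\<close>

lemma AE_increment:
  assumes n: "n \<ge> 1"
  shows "AE \<omega> in M. Z (Suc n) \<omega> = Z n \<omega> \<or> Z (Suc n) \<omega> = Suc (Z n \<omega>)"
proof -
  note [measurable] = Z_measurable[OF n] Z_measurable[of "Suc n", simplified]
  have "AE \<omega> in M. Z n \<omega> = j \<longrightarrow> Z (Suc n) \<omega> = j \<or> Z (Suc n) \<omega> = Suc j" for j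
  proof -
    let ?bad = "{\<omega> \<in> space M. Z n \<omega> = j \<and> Z (Suc n) \<omega> \<noteq> j \<and> Z (Suc n) \<omega> \<noteq> Suc j}"
    let ?up = "{\<omega> \<in> space M. Z (Suc n) \<omega> = Suc j \<and> Z n \<omega> = j}"
    let ?stay = "{\<omega> \<in> space M. Z (Suc n) \<omega> = j \<and> Z n \<omega> = j}"
    have "law n j = prob (?bad \<union> (?up \<union> ?stay))" by (intro arg_cong[of _ _ prob]) auto
    also have "\<dots> = prob ?bad + (prob ?up + prob ?stay)"
      by (subst finite_measure_Union; (subst finite_measure_Union)?) auto
    finally have "prob ?bad = 0" unfolding Z_up[OF n] Z_stay[OF n] by (simp add: algebra_simps)
    then have "AE \<omega> in M. \<omega> \<notin> ?bad" by (subst (asm) prob_eq_0) auto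
    then show ?thesis by (rule AE_mp) (auto intro!: AE_I2)
  qed
  then have "AE \<omega> in M. \<forall>j. Z n \<omega> = j \<longrightarrow> Z (Suc n) \<omega> = j \<or> Z (Suc n) \<omega> = Suc j"
    unfolding AE_all_countable by blast
  then show ?thesis by simp
qed

lemma law_Suc:
  assumes n: "n \<ge> 1"
  shows "law (Suc n) j = law n j * (real k * real j / real n)
      + (if j = 0 then 0 else law n (j - 1) * (1 - real k * real (j - 1) / real n))"
proof -
  note [measurable] = Z_measurable[OF n] Z_measurable[of "Suc n", simplified]
  let ?up = "{\<omega> \<in> space M. Z (Suc n) \<omega> = j \<and> Suc (Z n \<omega>) = j}"
  let ?stay = "{\<omega> \<in> space M. Z (Suc n) \<omega> = j \<and> Z n \<omega> = j}"
  have "law (Suc n) j = prob (?stay \<union> ?up)"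
  proof (rule finite_measure_eq_AE)
    show "AE \<omega> in M. \<omega> \<in> {\<omega> \<in> space M. Z (Suc n) \<omega> = j} \<longleftrightarrow> \<omega> \<in> ?stay \<union> ?up"
      using AE_increment[OF n] by eventually_elim auto
  qed measurable
  also have "\<dots> = prob ?stay + prob ?up" by (rule finite_measure_Union) auto
  also have "prob ?up = (if j = 0 then 0 else law n (j - 1) * (1 - real k * real (j - 1) / real n))"
    using Z_up[OF n, of "j - 1"] by (cases j) auto
  finally show ?thesis unfolding Z_stay[OF n] .
qed

lemma law_1: "law 1 j = (if j = k0 then 1 else 0)"
proof -
  note [measurable] = Z_measurable[of 1, simplified]
  have "law 1 j = prob {\<omega> \<in> space M. k0 = j}"
    using Z_init by (intro finite_measure_eq_AE) (auto elim!: eventually_mono)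
  then show ?thesis by (simp add: prob_space)
qed

lemma law_eq_coeff: "n \<ge> 1 \<Longrightarrow> law (Suc n) j = coeff (chain_poly k n) j"
proof (induction n arbitrary: j rule: nat_induct_at_least)
  case base
  \<comment> \<open>Both starting points lead to \<open>Z 2 = 1\<close> almost surely: 0 moves up
    with probability 1, and 1 (possible only for k = 1) stays with probability 1. This is the
    polynomial x at index 1.\<close>
  have "k0 = 0 \<or> k0 = 1 \<and> k = 1" using k k0 by (cases k0) auto
  then show ?case
    unfolding law_Suc[OF order_refl] law_1 by (cases j; cases "j - 1") auto
next
  case (Suc n)
  then show ?case
    unfolding law_Suc[of "Suc n", OF le_SucI[OF Suc.hyps]] coeff_chain_poly_Suc[OF Suc.hyps] by simp
qed

lemma AE_bounded:
  assumes "n \<ge> 1"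
  shows "\<exists>d. AE \<omega> in M. Z n \<omega> \<le> d"
proof (cases "n = 1")
  case True
  have "AE \<omega> in M. Z n \<omega> \<le> k0" using Z_init True by auto
  then show ?thesis by blast
next
  case False
  define m where "m = n - 1"
  have m: "n = Suc m" "m \<ge> 1" using False assms by (auto simp: m_def)
  note [measurable] = Z_measurable[OF assms]
  have "AE \<omega> in M. Z n \<omega> \<noteq> j" if "j > degree (chain_poly k m)" for j
  proof -
    have "law n j = 0" unfolding m(1) law_eq_coeff[OF m(2)] using that by (rule coeff_eq_0)
    then have "AE \<omega> in M. \<omega> \<notin> {\<omega> \<in> space M. Z n \<omega> = j}" by (subst (asm) prob_eq_0) auto
    then show ?thesis by (rule AE_mp) (auto intro!: AE_I2)
  qed
  then have "AE \<omega> in M. \<forall>j. j > degree (chain_poly k m) \<longrightarrow> Z n \<omega> \<noteq> j"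
    unfolding AE_all_countable by auto
  then have "AE \<omega> in M. Z n \<omega> \<le> degree (chain_poly k m)"
    by eventually_elim (metis not_le)
  then show ?thesis by blast
qed

lemma exp_integrable:
  assumes n: "n \<ge> 1"
  shows "integrable M (\<lambda>\<omega>. exp (l * real (Z n \<omega>)))"
proof -
  note [measurable] = Z_measurable[OF n]
  obtain d where d: "AE \<omega> in M. Z n \<omega> \<le> d" using AE_bounded[OF n] by blast
  show ?thesis
  proof (rule integrable_const_bound)
    show "AE \<omega> in M. norm (exp (l * real (Z n \<omega>))) \<le> exp (\<bar>l\<bar> * real d)"
      using d
    proof eventually_elim
      case (elim \<omega>)
      have "l * real (Z n \<omega>) \<le> \<bar>l\<bar> * real d" using elim by (intro mult_mono) auto
      then show ?case by simp
    qed
  qed measurable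
qed

section \<open>Moment generating function, pressure and large deviations of the chain\<close>

lemma mgf_eq_poly:
  assumes m: "m \<ge> 1"
  shows "(\<integral>\<omega>. exp (l * real (Z (Suc m) \<omega>)) \<partial>M) = poly (chain_poly k m) (exp l)"
proof -
  note [measurable] = Z_measurable[of "Suc m", simplified]
  obtain d where d: "AE \<omega> in M. Z (Suc m) \<omega> \<le> d" using AE_bounded[of "Suc m"] by auto
  \<comment> \<open>Large enough to cover both the values of the chain and the degree of the
    polynomial.\<close>
  define e where "e = max d (degree (chain_poly k m))"
  have "(\<integral>\<omega>. exp (l * real (Z (Suc m) \<omega>)) \<partial>M) =
      (\<integral>\<omega>. (\<Sum>j\<le>e. exp (l * real j) * indicator {\<omega> \<in> space M. Z (Suc m) \<omega> = j} \<omega>) \<partial>M)"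
  proof (rule integral_cong_AE)
    show "AE \<omega> in M. exp (l * real (Z (Suc m) \<omega>)) =
        (\<Sum>j\<le>e. exp (l * real j) * indicator {\<omega> \<in> space M. Z (Suc m) \<omega> = j} \<omega>)"
      using d AE_space
    proof eventually_elim
      case (elim \<omega>)
      have "(\<Sum>j\<le>e. exp (l * real j) * indicator {\<omega> \<in> space M. Z (Suc m) \<omega> = j} \<omega>)
          = (\<Sum>j\<le>e. if j = Z (Suc m) \<omega> then exp (l * real j) else 0)"
        using elim by (intro sum.cong) (auto simp: indicator_def)
      then show ?case using elim by (simp add: e_def)
    qed
  qed measurable
  also have "\<dots> = (\<Sum>j\<le>e. exp (l * real j) * law (Suc m) j)"
    by (subst Bochner_Integration.integral_sum) (auto intro!: integrable_mult_right integrable_real_indicator simp: less_top[symmetric])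
  also have "\<dots> = (\<Sum>j\<le>e. coeff (chain_poly k m) j * exp l ^ j)"
    by (intro sum.cong refl) (simp add: law_eq_coeff[OF m] exp_of_nat_mult[symmetric] mult.commute)
  also have "\<dots> = (\<Sum>j\<le>degree (chain_poly k m). coeff (chain_poly k m) j * exp l ^ j)"
    by (rule sum.mono_neutral_right) (auto simp: e_def coeff_eq_0)
  also have "\<dots> = poly (chain_poly k m) (exp l)" by (simp add: poly_altdef)
  finally show ?thesis .
qed

lemma log_mgf_rate_limit:
  "log_mgf_rate M (\<lambda>n \<omega>. real (Z n \<omega>)) l \<longlonglongrightarrow> - ln (blowup_integral k (exp l) 1)"
proof (rule LIMSEQ_imp_Suc)
  \<comment> \<open>The polynomial of index n belongs to time n + 1, so the normalisation changes by
    n / (n + 1).\<close>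
  have "(\<lambda>n. real n / real (Suc n)) \<longlonglongrightarrow> 1" by real_asymp
  from tendsto_mult[OF chain_poly_growth[OF exp_gt_zero k, of l] this]
  have "(\<lambda>n. ln (poly (chain_poly k n) (exp l)) / real n * (real n / real (Suc n)))
      \<longlonglongrightarrow> - ln (blowup_integral k (exp l) 1)" by simp
  then show "(\<lambda>n. log_mgf_rate M (\<lambda>n \<omega>. real (Z n \<omega>)) l (Suc n)) \<longlonglongrightarrow> - ln (blowup_integral k (exp l) 1)"
  proof (rule Lim_transform_eventually)
    show "eventually (\<lambda>n. ln (poly (chain_poly k n) (exp l)) / real n * (real n / real (Suc n))
        = log_mgf_rate M (\<lambda>n \<omega>. real (Z n \<omega>)) l (Suc n)) sequentially"
      using eventually_ge_at_top[of 1] by eventually_elim (simp add: log_mgf_rate_def mgf_eq_poly)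
  qed
qed

lemma pressure_eq: "pressure M (\<lambda>n \<omega>. real (Z n \<omega>)) l = - ln (blowup_integral k (exp l) 1)"
  unfolding pressure_def by (rule limI[OF log_mgf_rate_limit])

lemma large_deviations:
  "large_deviation_principle M (\<lambda>n \<omega>. real (Z n \<omega>) / real n)
     (legendre_transform (pressure M (\<lambda>n \<omega>. real (Z n \<omega>))))"
proof -
  let ?L = "\<lambda>l. - ln (blowup_integral k (exp l) 1)"
  have "\<exists>D. DERIV ?L l :> D" for l
  proof -
    obtain D where "((\<lambda>x. blowup_integral k x 1) has_real_derivative D) (at (exp l))"
      using blowup_integral_differentiable[OF exp_gt_zero[of l]] by blast
    from DERIV_chain2[OF this DERIV_exp]
    have "DERIV (\<lambda>l. blowup_integral k (exp l) 1) l :> D * exp l" .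
    moreover have "blowup_integral k (exp l) 1 > 0" by (rule blowup_integral_pos) auto
    ultimately show ?thesis by (intro exI) (auto intro!: derivative_eq_intros)
  qed
  then obtain L' where L': "\<And>l. DERIV ?L l :> L' l" by metis
  have "gaertner_ellis M (\<lambda>n \<omega>. real (Z n \<omega>)) ?L L'"
  proof unfold_locales
    fix n :: nat assume n: "n \<ge> 1"
    note [measurable] = Z_measurable[OF n]
    show "(\<lambda>\<omega>. real (Z n \<omega>)) \<in> borel_measurable M" by measurable
  qed (use exp_integrable log_mgf_rate_limit L' in auto)
  moreover have "pressure M (\<lambda>n \<omega>. real (Z n \<omega>)) = ?L" by (rule ext) (rule pressure_eq)
  ultimately show ?thesis using gaertner_ellis.large_deviations by metis
qed

end

section \<open>The theorem for \<alpha> = 1/2 and \<alpha> = 1\<close>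

theorem mainTheorem4:
  fixes \<alpha> :: real and s :: "nat \<Rightarrow> real" and k\<^sub>0 :: nat
    and M :: "'a measure" and Z :: "nat \<Rightarrow> 'a \<Rightarrow> nat"
  assumes alpha: "\<alpha> \<in> {1/2, 1}"
    and s: "\<And>n. n \<ge> 1 \<Longrightarrow> s n = \<alpha> * real n"
    and k0: "real k\<^sub>0 \<le> s 1"
    and chain: "discrete_markov_chain M Z"
    and init: "AE \<omega> in M. Z 1 \<omega> = k\<^sub>0"
    and up: "\<And>n k. n \<ge> 1 \<Longrightarrow> \<P>(\<omega> in M. Z n \<omega> = k) > 0 \<Longrightarrow>
        \<P>(\<omega> in M. real (Z (Suc n) \<omega>) - real (Z n \<omega>) = 1 \<bar> Z n \<omega> = k) = 1 - real k / s n"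
    and stay: "\<And>n k. n \<ge> 1 \<Longrightarrow> \<P>(\<omega> in M. Z n \<omega> = k) > 0 \<Longrightarrow>
        \<P>(\<omega> in M. real (Z (Suc n) \<omega>) - real (Z n \<omega>) = 0 \<bar> Z n \<omega> = k) = real k / s n"
  shows "large_deviation_principle M (\<lambda>n \<omega>. real (Z n \<omega>) / real n)
           (legendre_transform (pressure M (\<lambda>n \<omega>. real (Z n \<omega>))))
       \<and> (\<forall>l. convergent (log_mgf_rate M (\<lambda>n \<omega>. real (Z n \<omega>)) l))
       \<and> (\<forall>l. l \<noteq> 0 \<longrightarrow> pressure M (\<lambda>n \<omega>. real (Z n \<omega>)) l =
            - ln (\<alpha> / (exp l - 1) *
                 (LBINT t=ereal 0..ereal l. ((exp t - 1) / (exp l - 1)) powr (\<alpha> - 1))))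
       \<and> pressure M (\<lambda>n \<omega>. real (Z n \<omega>)) 0 = 0"
proof -
  obtain k :: nat where k_alpha: "k \<in> {1, 2}" "\<alpha> = 1 / real k"
    using alpha that[of 1] that[of 2] by auto
  have s_eq: "real j / s n = real k * real j / real n" if "n \<ge> 1" for n j
    using s[OF that] k_alpha by auto
  interpret prob_space M using chain by (simp add: discrete_markov_chain_def)
  have meas: "Z n \<in> M \<rightarrow>\<^sub>M count_space UNIV" if "n \<ge> 1" for n
    using chain that by (simp add: discrete_markov_chain_def)
  \<comment> \<open>Conditional probabilities become joint ones; at a null state both sides vanish
    by monotonicity.\<close>
  have joint: "prob {\<omega> \<in> space M. Z (Suc n) \<omega> = i \<and> Z n \<omega> = j} = prob {\<omega> \<in> space M. Z n \<omega> = j} * c"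
    if n: "n \<ge> 1" and c: "prob {\<omega> \<in> space M. Z n \<omega> = j} > 0 \<Longrightarrow>
      \<P>(\<omega> in M. real (Z (Suc n) \<omega>) - real (Z n \<omega>) = d \<bar> Z n \<omega> = j) = c" and d: "d = real i - real j" for n i j c d
  proof (cases "prob {\<omega> \<in> space M. Z n \<omega> = j} > 0")
    case True
    have "{\<omega> \<in> space M. real (Z (Suc n) \<omega>) - real (Z n \<omega>) = d \<and> Z n \<omega> = j}
        = {\<omega> \<in> space M. Z (Suc n) \<omega> = i \<and> Z n \<omega> = j}" using d by auto
    then show ?thesis using c[OF True] True by (simp add: cond_prob_def field_simps)
  next
    case False
    note [measurable] = meas[OF n]
    have "prob {\<omega> \<in> space M. Z (Suc n) \<omega> = i \<and> Z n \<omega> = j} \<le> prob {\<omega> \<in> space M. Z n \<omega> = j}"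
      by (rule finite_measure_mono) auto
    then show ?thesis using False by (simp add: not_less measure_le_0_iff)
  qed
  interpret lazy_increment_chain M Z k k\<^sub>0
  proof
    have "real (k * k\<^sub>0) \<le> 1" using k0 s[of 1] k_alpha by (auto simp: field_simps)
    then show "k * k\<^sub>0 \<le> 1" by linarith
    fix n j :: nat assume n: "n \<ge> 1"
    show "prob {\<omega> \<in> space M. Z (Suc n) \<omega> = Suc j \<and> Z n \<omega> = j}
        = prob {\<omega> \<in> space M. Z n \<omega> = j} * (1 - real k * real j / real n)"
      by (rule joint[OF n, of _ 1]) (use up[OF n] s_eq[OF n] in auto)
    show "prob {\<omega> \<in> space M. Z (Suc n) \<omega> = j \<and> Z n \<omega> = j}
        = prob {\<omega> \<in> space M. Z n \<omega> = j} * (real k * real j / real n)"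
      by (rule joint[OF n, of _ 0]) (use stay[OF n] s_eq[OF n] in auto)
  qed (use k_alpha(1) meas init in auto)
  have "k \<ge> 1" using k_alpha by auto
  then show ?thesis
    using large_deviations log_mgf_rate_limit pressure_eq
      interval_integral_eq_blowup_integral[OF _ _ k_alpha(2)]
    by (auto simp: convergent_def)
qed

end
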